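(* Let $G$ be a Cayley graph of a finitely presented amenable group with one end. Let $C$ be the open connected component of the identity element under Bernoulli bond percolation on $G$. Then there is a sequence $(\alpha_n)_{n\ge1}$ of real numbers with $\alpha_n=o(n)$ such that for every $p$ with $p_c(G)<p<1$ there is $\eta(p)<\infty$ with $$\mathbb{P}_p(n\le|C|<\infty)\ge \exp(-\eta(p)\,\alpha_n)\qquad\text{for all } n\ge1.$$
   Context: Cayley graph: given a finitely generated group $\bar G$ and a finite symmetric generating set $\mathcal S=\mathcal S^{-1}$, the (left-)Cayley graph has vertex set $\bar G$ and edge set $\{\{u,v\}: v=su \text{ for some } s\in\mathcal S\}$. A group is finitely presented if it is described by finitely many generators and relations. An infinite, locally finite, connected graph is amenable if $\inf\{|\partial W|/|W| : \emptyset\ne W\subseteq V(G),\ |W|<\infty\}=0$, where $\partial W$ is the set of vertices outside $W$ adjacent to some vertex of $W$; a finitely generated group is amenable if its Cayley graph is. A graph is one-ended if after removal of any finite set of vertices there remains exactly one infinite component; a group has one end if its Cayley graph is one-ended (this does not depend on the generating set). $\mathbb{P}_p$ is the probability measure under which each edge is independently open with probability $p$ and closed otherwise; open connected components are the connected components of the subgraph of open edges. $|C|$ is the number of vertices of $C$. $p_c(G)=\inf\{p\in[0,1]: \mathbb{P}_p(\text{there is an infinite open cluster})=1\}$. *)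

theory Defs
  imports "HOL-Probability.Probability" "HOL-Algebra.Generated_Groups"
    "HOL-Library.Landau_Symbols"
begin

text \<open>
  A graph is given by a vertex set \<open>V\<close> and a set \<open>E\<close> of unordered edges \<open>{u, v}\<close>.
  Edges of \<open>E\<close> with an endpoint outside \<open>V\<close> are ignored, so that
  \<open>(V - F, E)\<close> stands for the graph with the vertices \<open>F\<close> removed.
\<close>

definition adj :: "'a set \<Rightarrow> 'a set set \<Rightarrow> ('a \<times> 'a) set" where
  "adj V E = {(u, v). u \<in> V \<and> v \<in> V \<and> {u, v} \<in> E}"

definition component_of :: "'a set \<Rightarrow> 'a set set \<Rightarrow> 'a \<Rightarrow> 'a set" where
  "component_of V E x = {y. (x, y) \<in> (adj V E)\<^sup>*}"

definition graph_components :: "'a set \<Rightarrow> 'a set set \<Rightarrow> 'a set set" where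
  "graph_components V E = component_of V E ` V"

definition connected_graph :: "'a set \<Rightarrow> 'a set set \<Rightarrow> bool" where
  "connected_graph V E \<longleftrightarrow> (\<forall>x\<in>V. \<forall>y\<in>V. (x, y) \<in> (adj V E)\<^sup>*)"

definition locally_finite_graph :: "'a set \<Rightarrow> 'a set set \<Rightarrow> bool" where
  "locally_finite_graph V E \<longleftrightarrow> (\<forall>x\<in>V. finite {y. (x, y) \<in> adj V E})"

definition vertex_boundary :: "'a set \<Rightarrow> 'a set set \<Rightarrow> 'a set \<Rightarrow> 'a set" where
  "vertex_boundary V E W = {v \<in> V - W. \<exists>w\<in>W. (w, v) \<in> adj V E}"

definition amenable_graph :: "'a set \<Rightarrow> 'a set set \<Rightarrow> bool" where
  "amenable_graph V E \<longleftrightarrow>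
     infinite V \<and> locally_finite_graph V E \<and> connected_graph V E \<and>
     Inf {real (card (vertex_boundary V E W)) / real (card W) | W.
            W \<noteq> {} \<and> W \<subseteq> V \<and> finite W} = 0"

definition one_ended_graph :: "'a set \<Rightarrow> 'a set set \<Rightarrow> bool" where
  "one_ended_graph V E \<longleftrightarrow>
     (\<forall>F. finite F \<and> F \<subseteq> V \<longrightarrow> (\<exists>!C. C \<in> graph_components (V - F) E \<and> infinite C))"

definition symmetric_generating_set :: "('a, 'b) monoid_scheme \<Rightarrow> 'a set \<Rightarrow> bool" where
  "symmetric_generating_set G S \<longleftrightarrow>
     finite S \<and> S \<subseteq> carrier G \<and> (\<lambda>s. inv\<^bsub>G\<^esub> s) ` S = S \<and> generate G S = carrier G"

text \<open>
  The identity is allowed in \<open>S\<close>; it contributes loops \<open>{u}\<close>, which affect neither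
  components nor boundaries.
\<close>

definition cayley_edges :: "('a, 'b) monoid_scheme \<Rightarrow> 'a set \<Rightarrow> 'a set set" where
  "cayley_edges G S = {{u, v} | u v. u \<in> carrier G \<and> v \<in> carrier G \<and> (\<exists>s\<in>S. v = s \<otimes>\<^bsub>G\<^esub> u)}"

text \<open>
  Amenability and one-endedness of a finitely generated group do not depend on the
  generating set; we ask for some finite symmetric generating set, which need not be
  the one whose Cayley graph is percolated.
\<close>

definition amenable_group :: "('a, 'b) monoid_scheme \<Rightarrow> bool" where
  "amenable_group G \<longleftrightarrow>
     (\<exists>S. symmetric_generating_set G S \<and> amenable_graph (carrier G) (cayley_edges G S))"

definition one_ended_group :: "('a, 'b) monoid_scheme \<Rightarrow> bool" where
  "one_ended_group G \<longleftrightarrow>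
     (\<exists>S. symmetric_generating_set G S \<and> one_ended_graph (carrier G) (cayley_edges G S))"

text \<open>
  The group presented by generators \<open>x\<^sub>0, \<dots>, x\<^bsub>n-1\<^esub>\<close> and relators \<open>R\<close>: words over the
  letters \<open>x\<^sub>i = (i, True)\<close> and their formal inverses \<open>(i, False)\<close>, modulo insertion and
  deletion of relators and of the cancelling pairs \<open>x\<^sub>i x\<^sub>i\<inverse>\<close>, \<open>x\<^sub>i\<inverse> x\<^sub>i\<close>.
\<close>

type_synonym word = "(nat \<times> bool) list"

definition words :: "nat \<Rightarrow> word set" where
  "words n = lists ({..<n} \<times> UNIV)"

definition cancelling_pairs :: "nat \<Rightarrow> word set" where
  "cancelling_pairs n = {[(i, b), (i, \<not> b)] | i b. i < n}"

definition deletions :: "nat \<Rightarrow> word set \<Rightarrow> (word \<times> word) set" where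
  "deletions n R = {(u @ r @ v, u @ v) | u r v.
     u \<in> words n \<and> v \<in> words n \<and> r \<in> R \<union> cancelling_pairs n}"

definition word_equiv :: "nat \<Rightarrow> word set \<Rightarrow> (word \<times> word) set" where
  "word_equiv n R = (deletions n R \<union> (deletions n R)\<inverse>)\<^sup>*"

definition presented_group :: "nat \<Rightarrow> word set \<Rightarrow> word set monoid" where
  "presented_group n R =
     \<lparr>carrier = words n // word_equiv n R,
      mult = (\<lambda>A B. \<Union>u\<in>A. \<Union>v\<in>B. word_equiv n R `` {u @ v}),
      one = word_equiv n R `` {[]}\<rparr>"

definition finitely_presented_group :: "('a, 'b) monoid_scheme \<Rightarrow> bool" where
  "finitely_presented_group G \<longleftrightarrow>
     (\<exists>n R. finite R \<and> R \<subseteq> words n \<and> G \<cong> presented_group n R)"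

text \<open>
  Bernoulli bond percolation: a configuration \<open>\<omega>\<close> assigns \<open>True\<close> (open) or
  \<open>False\<close> (closed) to each edge.
\<close>

definition bond_percolation :: "'a set set \<Rightarrow> real \<Rightarrow> ('a set \<Rightarrow> bool) measure" where
  "bond_percolation E p = (\<Pi>\<^sub>M e\<in>E. measure_pmf (bernoulli_pmf p))"

definition open_cluster :: "'a set \<Rightarrow> 'a set set \<Rightarrow> ('a set \<Rightarrow> bool) \<Rightarrow> 'a \<Rightarrow> 'a set" where
  "open_cluster V E \<omega> x = component_of V {e \<in> E. \<omega> e} x"

definition critical_probability :: "'a set \<Rightarrow> 'a set set \<Rightarrow> real" where
  "critical_probability V E =
     Inf {p \<in> {0..1}. measure (bond_percolation E p)
            {\<omega> \<in> space (bond_percolation E p). \<exists>x\<in>V. infinite (open_cluster V E \<omega> x)} = 1}"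

end

theory Submission
  imports Defs
begin

text \<open>
  Suppose that \<open>W\<close> is a finite set of vertices and that \<open>T\<close> is a finite connected set which
  contains every vertex of \<open>W\<close> with a neighbour outside \<open>W\<close> (the rim of \<open>W\<close>). In supercritical
  percolation a vertex lies in an infinite cluster with probability \<open>\<theta> > 0\<close>, so the expected
  number of such vertices in \<open>W\<close> is \<open>\<theta> |W|\<close>. Now open all edges inside \<open>T\<close> and close all edges that
  leave \<open>W \<union> T\<close>. A vertex of \<open>W\<close> in an infinite cluster was joined to the rim inside \<open>W\<close>, and this
  connection survives; as \<open>T\<close> is connected, all these vertices now share one cluster, which is
  contained in \<open>W \<union> T\<close> and hence finite (\<open>surgery\<close>). The change involves at most \<open>|S| |T|\<close> edges, so
  that it costs a factor exponential in \<open>|T|\<close> (\<open>finite_energy\<close>). By translation invariance all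
  vertices of \<open>W\<close> are equally good, and averaging over \<open>W\<close> with \<open>|W| \<ge> 2 n / \<theta>\<close> gives
  \<open>P(n \<le> |C| < \<infinity>) \<ge> (\<theta> / 2) (p (1 - p))\<^bsup>|S| |T|\<^esup>\<close> (\<open>cluster_tail_lower_bound\<close>).

  It remains to find such pairs with \<open>|W| \<ge> m\<close> and \<open>|T| = o(m)\<close> (\<open>cheap_sealed_sets\<close>). Amenability
  provides a connected set \<open>A\<close> with a small rim, but the points of the rim still have to be
  connected to each other. For this take a maximal set \<open>N\<close> of points of \<open>A\<close> with pairwise distance
  more than \<open>2 r\<close>. Since the balls of radius \<open>r\<close> about \<open>N\<close> are disjoint, \<open>|N|\<close> is at most about
  \<open>|A|\<close> divided by the volume of such a ball, and \<open>N\<close> can be joined up by paths of length at most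
  \<open>2 r + 1\<close>. The cost is thus about \<open>|A|\<close> times \<open>2 r + 1\<close> divided by the volume, and this is small
  compared to \<open>|A|\<close> as soon as the volume of balls grows faster than linearly (\<open>skeleton\<close>). A
  one-ended group has this property, because its spheres become arbitrarily large: if a long
  geodesic that points towards the identity passes through \<open>x\<close>, then its two ends can be joined by
  a detour outside any given smaller ball about \<open>x\<close>, and this detour crosses the sphere about the
  identity through \<open>x\<close> in a further point
  (\<open>level_set_large\<close>). For arbitrarily large \<open>m\<close>, disjoint translates of \<open>A\<close> are then strung
  together by short paths (\<open>chain_of_tiles\<close>).

  The bound is needed at \<open>m = k n\<close> with a factor \<open>k \<ge> 2 / \<theta>\<close> that depends on \<open>p\<close>, whereas the
  sequence may not depend on \<open>p\<close>. If \<open>f(m) = o(m)\<close>, then \<open>n\<close> times the supremum of \<open>f(m) / m\<close>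
  over \<open>m \<ge> n\<close> is a sublinear sequence that dominates \<open>f(k n) / k\<close> for every \<open>k\<close> at once
  (\<open>scaling_majorant\<close>).
\<close>

section \<open>Paths and connected sets\<close>

lemma adj_mono: "A \<subseteq> B \<Longrightarrow> adj A E \<subseteq> adj B E"
  by (auto simp: adj_def)

lemma adj_sym: "sym (adj A E)"
  by (auto simp: adj_def sym_def insert_commute)

lemma adj_rtrancl_sym: "(x, y) \<in> (adj A E)\<^sup>* \<Longrightarrow> (y, x) \<in> (adj A E)\<^sup>*"
  by (meson adj_sym sym_rtrancl symE)

lemma adj_rtrancl_mono: "(x, y) \<in> (adj A E)\<^sup>* \<Longrightarrow> A \<subseteq> B \<Longrightarrow> (x, y) \<in> (adj B E)\<^sup>*"
  using rtrancl_mono[OF adj_mono] by blast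

lemma connected_graph_Un:
  assumes "connected_graph A E" "connected_graph B E" "z \<in> A" "z \<in> B"
  shows "connected_graph (A \<union> B) E"
proof -
  have "(x, z) \<in> (adj (A \<union> B) E)\<^sup>*" if "x \<in> A \<union> B" for x
    using that assms adj_rtrancl_mono[of x z A E "A \<union> B"] adj_rtrancl_mono[of x z B E "A \<union> B"]
    unfolding connected_graph_def by blast
  then show ?thesis
    unfolding connected_graph_def by (meson adj_rtrancl_sym rtrancl_trans)
qed

lemma rtrancl_exits:
  assumes "(x, y) \<in> r\<^sup>*" "x \<in> A" "y \<notin> A"
  obtains u v where "(x, u) \<in> r\<^sup>*" "u \<in> A" "(u, v) \<in> r" "v \<notin> A"
proof -
  have "y \<in> A \<or> (\<exists>u v. (x, u) \<in> r\<^sup>* \<and> u \<in> A \<and> (u, v) \<in> r \<and> v \<notin> A)"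
    using assms(1) by (induction rule: rtrancl_induct) (use assms(2) in auto)
  with assms(3) that show thesis by auto
qed

lemma adj_rtrancl_closed: "(x, y) \<in> (adj A E)\<^sup>* \<Longrightarrow> x \<in> A \<Longrightarrow> y \<in> A"
  by (induction rule: rtrancl_induct) (auto simp: adj_def)

lemma path_within_finite_set:
  assumes "(x, y) \<in> (adj A E)\<^sup>*" "x \<in> A"
  shows "\<exists>B. finite B \<and> B \<subseteq> A \<and> x \<in> B \<and> (x, y) \<in> (adj B E)\<^sup>*"
  using assms(1)
proof (induction rule: rtrancl_induct)
  case base
  then show ?case using assms(2) by (intro exI[of _ "{x}"]) auto
next
  case (step y z)
  then obtain B where B: "finite B" "B \<subseteq> A" "x \<in> B" "(x, y) \<in> (adj B E)\<^sup>*" by blast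
  let ?B = "insert z B"
  have "(x, y) \<in> (adj ?B E)\<^sup>*" by (rule adj_rtrancl_mono[OF B(4)]) auto
  moreover have "y \<in> B" using B adj_rtrancl_closed by metis
  then have "(y, z) \<in> adj ?B E" using step(2) by (auto simp: adj_def)
  moreover have "z \<in> A" using step(2) by (auto simp: adj_def)
  ultimately show ?case using B by (intro exI[of _ ?B]) auto
qed

text \<open>A discrete intermediate value theorem.\<close>

lemma path_attains_level:
  fixes f :: "'a \<Rightarrow> nat"
  assumes "(x, y) \<in> r\<^sup>*" "f x \<le> t" "t \<le> f y"
    and step: "\<And>u v. (u, v) \<in> r \<Longrightarrow> f v \<le> f u + 1"
  shows "\<exists>z. (x, z) \<in> r\<^sup>* \<and> f z = t"
proof (cases "f y = t")
  case False
  then obtain u v where "(x, u) \<in> r\<^sup>*" "f u \<le> t" "(u, v) \<in> r" "\<not> f v \<le> t"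
    using rtrancl_exits[OF assms(1), of "{u. f u \<le> t}"] assms(2,3) by auto
  moreover from this step[of u v] have "f u = t" by auto
  ultimately show ?thesis by blast
qed (use assms(1) in blast)

section \<open>Cayley graphs and the word metric\<close>

text \<open>The locale fixes a generating set of its own because amenability and one-endedness of the group
are witnessed by generating sets that may differ from each other and from the one that defines
the percolated graph; facts about several generating sets are obtained by several interpretations.\<close>

locale marked_group = group G for G (structure) +
  fixes S :: "'a set"
  assumes symgen: "symmetric_generating_set G S"
begin

abbreviation "V \<equiv> carrier G"
abbreviation "E \<equiv> cayley_edges G S"

lemma finite_S: "finite S" and S_carrier: "S \<subseteq> V" and gen_S: "generate G S = V"
  and inv_S_eq: "(\<lambda>s. inv s) ` S = S"
  using symgen by (auto simp: symmetric_generating_set_def)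

lemma S_closed [simp]: "s \<in> S \<Longrightarrow> s \<in> V"
  using S_carrier by auto

lemma inv_S [simp]: "s \<in> S \<Longrightarrow> inv s \<in> S"
  using inv_S_eq by blast

lemma inv_mult_cancel [simp]: "a \<in> V \<Longrightarrow> b \<in> V \<Longrightarrow> inv a \<otimes> (a \<otimes> b) = b"
  "a \<in> V \<Longrightarrow> b \<in> V \<Longrightarrow> a \<otimes> (inv a \<otimes> b) = b"
  "a \<in> V \<Longrightarrow> b \<in> V \<Longrightarrow> a \<otimes> b \<otimes> inv b = a"
  "a \<in> V \<Longrightarrow> b \<in> V \<Longrightarrow> a \<otimes> inv b \<otimes> b = a"
  by (auto simp: m_assoc[symmetric]) (auto simp: m_assoc)

lemma edge_iff: "u \<in> V \<Longrightarrow> {u, v} \<in> E \<longleftrightarrow> (\<exists>s\<in>S. v = s \<otimes> u)"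
proof
  assume u: "u \<in> V" and e: "{u, v} \<in> E"
  then obtain a b s where ab: "{u, v} = {a, b}" "a \<in> V" "b \<in> V" "s \<in> S" "b = s \<otimes> a"
    by (auto simp: cayley_edges_def)
  show "\<exists>s\<in>S. v = s \<otimes> u"
  proof (cases "u = a \<and> v = b")
    case False
    then have "u = b" "v = a" using ab(1) by (auto simp: doubleton_eq_iff)
    with ab show ?thesis by (intro bexI[of _ "inv s"]) auto
  qed (use ab in auto)
next
  assume u: "u \<in> V" and "\<exists>s\<in>S. v = s \<otimes> u"
  then obtain s where s: "s \<in> S" "v = s \<otimes> u" by blast
  then have "v \<in> V" using u by simp
  then show "{u, v} \<in> E" unfolding cayley_edges_def using u s by blast
qed

lemma adj_iff: "A \<subseteq> V \<Longrightarrow> (u, v) \<in> adj A E \<longleftrightarrow> u \<in> A \<and> v \<in> A \<and> (\<exists>s\<in>S. v = s \<otimes> u)"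
  using edge_iff by (auto simp: adj_def)

lemma adjE:
  assumes "(u, v) \<in> adj A E" "A \<subseteq> V"
  obtains s where "s \<in> S" "v = s \<otimes> u" "u \<in> A" "v \<in> A"
  using assms(1) unfolding adj_iff[OF assms(2)] by (elim conjE bexE)

lemma adjI: "A \<subseteq> V \<Longrightarrow> u \<in> A \<Longrightarrow> s \<otimes> u \<in> A \<Longrightarrow> s \<in> S \<Longrightarrow> (u, s \<otimes> u) \<in> adj A E"
  by (subst adj_iff) auto

text \<open>The ball of radius \<open>n\<close> about the identity. Since edges join \<open>u\<close> to \<open>s \<otimes> u\<close>, the distance of \<open>u\<close>
and \<open>v\<close> is the word length of \<open>v \<otimes> inv u\<close>, and right multiplications act by isometries.\<close>

primrec wball :: "nat \<Rightarrow> 'a set" where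
  "wball 0 = {\<one>}"
| "wball (Suc n) = wball n \<union> (\<lambda>(s, g). s \<otimes> g) ` (S \<times> wball n)"

lemma finite_wball [simp]: "finite (wball n)"
  by (induction n) (auto simp: finite_S)

lemma wball_carrier: "wball n \<subseteq> V"
  by (induction n) auto

lemma wball_closed [simp]: "g \<in> wball n \<Longrightarrow> g \<in> V"
  using wball_carrier by auto

lemma one_in_wball [simp]: "\<one> \<in> wball n"
  by (induction n) auto

lemma wball_mono: "m \<le> n \<Longrightarrow> wball m \<subseteq> wball n"
  by (induction n) (auto simp: le_Suc_eq)

lemma S_mult_wball: "s \<in> S \<Longrightarrow> g \<in> wball n \<Longrightarrow> s \<otimes> g \<in> wball (Suc n)"
  by force

lemma S_in_wball: "s \<in> S \<Longrightarrow> s \<in> wball (Suc 0)"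
  by force

lemma wball_mult: "g \<in> wball m \<Longrightarrow> h \<in> wball n \<Longrightarrow> g \<otimes> h \<in> wball (m + n)"
proof (induction m arbitrary: g)
  case (Suc m)
  show ?case
  proof (cases "g \<in> wball m")
    case True
    then show ?thesis using Suc by auto
  next
    case False
    then obtain s g' where g: "s \<in> S" "g' \<in> wball m" "g = s \<otimes> g'" using Suc.prems by auto
    then have "s \<otimes> (g' \<otimes> h) \<in> wball (Suc (m + n))"
      using Suc by (intro S_mult_wball) auto
    then show ?thesis using g Suc.prems by (simp add: m_assoc del: wball.simps)
  qed
qed auto

lemma inv_wball: "g \<in> wball n \<Longrightarrow> inv g \<in> wball n"
proof (induction n arbitrary: g)
  case (Suc n)
  show ?case
  proof (cases "g \<in> wball n")
    case False
    then obtain s g' where g: "s \<in> S" "g' \<in> wball n" "g = s \<otimes> g'" using Suc.prems by auto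
    then have "inv g' \<otimes> inv s \<in> wball (n + Suc 0)"
      using Suc by (intro wball_mult S_in_wball) auto
    then show ?thesis using g Suc.prems by (simp add: inv_mult_group del: wball.simps)
  qed (use Suc in auto)
qed auto

lemma in_some_wball: "g \<in> V \<Longrightarrow> \<exists>n. g \<in> wball n"
  unfolding gen_S[symmetric]
proof (induction rule: generate.induct)
  case one
  then show ?case using one_in_wball by blast
next
  case (incl h)
  then show ?case using S_in_wball by blast
next
  case (inv h)
  then show ?case using S_in_wball inv_S by blast
next
  case (eng h1 h2)
  then show ?case using wball_mult by blast
qed

lemma wball_Un: "(\<Union>n. wball n) = V"
  using in_some_wball by auto

lemma countable_V: "countable V"
  unfolding wball_Un[symmetric] by (intro countable_UN) (auto intro: countable_finite)

lemma finite_subset_wball: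
  assumes "finite A" "A \<subseteq> V"
  shows "\<exists>n\<ge>m. A \<subseteq> wball n"
  using assms
proof (induction rule: finite_induct)
  case empty
  then show ?case by auto
next
  case (insert x A)
  then obtain n k where "m \<le> n" "A \<subseteq> wball n" "x \<in> wball k" using in_some_wball[of x] by auto
  moreover have "wball n \<subseteq> wball (n + k)" "wball k \<subseteq> wball (n + k)" using wball_mono by auto
  ultimately show ?case by (intro exI[of _ "n + k"]) auto
qed

definition len :: "'a \<Rightarrow> nat" where
  "len g = (LEAST n. g \<in> wball n)"

lemma in_wball_iff: "g \<in> V \<Longrightarrow> g \<in> wball n \<longleftrightarrow> len g \<le> n"
proof
  assume "g \<in> V" "g \<in> wball n"
  then show "len g \<le> n" unfolding len_def by (intro Least_le)
next
  assume "g \<in> V" "len g \<le> n"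
  then have "g \<in> wball (len g)" unfolding len_def using in_some_wball[of g] LeastI_ex by metis
  then show "g \<in> wball n" using wball_mono[OF \<open>len g \<le> n\<close>] by blast
qed

\<comment> \<open>As rewrite rules this fact and in_wball_iff would call each other forever.\<close>
declare wball_closed [simp del]

lemma wball_eq: "wball n = {g \<in> V. len g \<le> n}"
  using in_wball_iff wball_carrier by blast

lemma len_le: "g \<in> wball n \<Longrightarrow> len g \<le> n"
  by (simp add: wball_eq)

lemma len_mult: "g \<in> V \<Longrightarrow> h \<in> V \<Longrightarrow> len (g \<otimes> h) \<le> len g + len h"
  by (intro len_le wball_mult) (auto simp: in_wball_iff)

lemma len_inv [simp]: "g \<in> V \<Longrightarrow> len (inv g) = len g"
  using inv_wball[of g "len g"] inv_wball[of "inv g" "len (inv g)"]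
  by (simp add: in_wball_iff)

lemma len_one [simp]: "len \<one> = 0"
  using len_le[of "\<one>" 0] by simp

lemma len_S: "s \<in> S \<Longrightarrow> len s \<le> 1"
  using S_in_wball len_le by fastforce

lemma len_step: "s \<in> S \<Longrightarrow> g \<in> V \<Longrightarrow> len (s \<otimes> g) \<le> len g + 1"
  using len_mult[of s g] len_S[of s] by simp

lemma wball_factor: "g \<in> wball (m + n) \<Longrightarrow> \<exists>h\<in>wball m. \<exists>k\<in>wball n. g = h \<otimes> k"
proof (induction m arbitrary: g)
  case 0
  then show ?case by (simp add: wball_closed)
next
  case (Suc m)
  show ?case
  proof (cases "g \<in> wball (m + n)")
    case True
    then obtain h k where "h \<in> wball m" "k \<in> wball n" "g = h \<otimes> k" using Suc.IH by blast
    moreover have "h \<in> wball (Suc m)" using \<open>h \<in> wball m\<close> by simp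
    ultimately show ?thesis by blast
  next
    case False
    then obtain s g' where g: "s \<in> S" "g' \<in> wball (m + n)" "g = s \<otimes> g'" using Suc.prems by auto
    then obtain h k where hk: "h \<in> wball m" "k \<in> wball n" "g' = h \<otimes> k" using Suc.IH by blast
    then have "g = (s \<otimes> h) \<otimes> k" using g by (simp add: m_assoc wball_closed)
    then show ?thesis using hk S_mult_wball[OF g(1) hk(1)] by blast
  qed
qed

text \<open>Splitting a shortest word for \<open>g\<close> produces points on a geodesic at any prescribed distance.\<close>

lemma len_factor:
  assumes "g \<in> V" "len g = m + n"
  obtains h k where "h \<in> V" "k \<in> V" "g = h \<otimes> k" "len h = m" "len k = n"
proof -
  have "g \<in> wball (m + n)" using assms in_wball_iff by auto
  then obtain h k where hk: "h \<in> wball m" "k \<in> wball n" "g = h \<otimes> k" using wball_factor by blast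
  then have "len h \<le> m" "len k \<le> n" "m + n \<le> len h + len k"
    using len_le len_mult[of h k] assms wball_closed by auto
  then have "len h = m" "len k = n" by auto
  then show thesis using that hk wball_closed by blast
qed

lemma ex_len:
  assumes "infinite V"
  shows "\<exists>g\<in>V. len g = n"
proof -
  have "\<not> V \<subseteq> wball n" using assms finite_subset[of V "wball n"] finite_wball by metis
  then obtain g where g: "g \<in> V" "g \<notin> wball n" by auto
  then have "n < len g" using in_wball_iff[OF g(1)] by auto
  then have "len g = n + (len g - n)" by simp
  from len_factor[OF g(1) this] show ?thesis by blast
qed

lemma path_between:
  "u \<in> V \<Longrightarrow> g \<in> wball n \<Longrightarrow>
    \<exists>P. P \<subseteq> V \<and> finite P \<and> card P \<le> n + 1 \<and> u \<in> P \<and> g \<otimes> u \<in> P \<and> connected_graph P E"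
proof (induction n arbitrary: g)
  case 0
  then show ?case by (intro exI[of _ "{u}"]) (auto simp: connected_graph_def)
next
  case (Suc n)
  show ?case
  proof (cases "g \<in> wball n")
    case True
    obtain P where "P \<subseteq> V" "finite P" "card P \<le> n + 1" "u \<in> P" "g \<otimes> u \<in> P" "connected_graph P E"
      using Suc.IH[OF Suc.prems(1) True] by blast
    then show ?thesis by (intro exI[of _ P]) auto
  next
    case False
    then obtain s g' where g: "s \<in> S" "g' \<in> wball n" "g = s \<otimes> g'" using Suc.prems by auto
    obtain P where P: "P \<subseteq> V" "finite P" "card P \<le> n + 1" "u \<in> P" "g' \<otimes> u \<in> P" "connected_graph P E"
      using Suc.IH[OF Suc.prems(1) g(2)] by blast
    have gu: "g \<otimes> u = s \<otimes> (g' \<otimes> u)" using g Suc.prems(1) by (simp add: m_assoc wball_closed)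
    have gV: "g \<in> V" using Suc.prems wball_closed by blast
    have "connected_graph {g' \<otimes> u, g \<otimes> u} E"
    proof -
      have "(g' \<otimes> u, g \<otimes> u) \<in> adj {g' \<otimes> u, g \<otimes> u} E"
        unfolding gu using g(1) Suc.prems(1) wball_closed[OF g(2)] by (subst adj_iff) auto
      then have "(g' \<otimes> u, g \<otimes> u) \<in> (adj {g' \<otimes> u, g \<otimes> u} E)\<^sup>*"
        "(g \<otimes> u, g' \<otimes> u) \<in> (adj {g' \<otimes> u, g \<otimes> u} E)\<^sup>*"
        by (auto intro: adj_rtrancl_sym)
      then show ?thesis unfolding connected_graph_def by blast
    qed
    from connected_graph_Un[OF P(6) this P(5)] have "connected_graph (insert (g \<otimes> u) P) E"
      using P(5) by (simp add: insert_absorb Un_insert_right)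
    moreover have "card (insert (g \<otimes> u) P) \<le> Suc n + 1"
      using P card_insert_le_m1[of "Suc n + 1" P "g \<otimes> u"] by simp
    ultimately show ?thesis using P Suc.prems(1) gV
      by (intro exI[of _ "insert (g \<otimes> u) P"]) auto
  qed
qed

lemma S_closed_subset_trivial:
  assumes "A \<subseteq> V" "A \<noteq> {}" "\<And>a s. a \<in> A \<Longrightarrow> s \<in> S \<Longrightarrow> s \<otimes> a \<in> A"
  shows "A = V"
proof -
  obtain a where a: "a \<in> A" using assms by auto
  have *: "g \<otimes> a \<in> A" if "g \<in> wball n" for g n
    using that
  proof (induction n arbitrary: g)
    case (Suc n)
    then show ?case using assms a by (auto simp: m_assoc subsetD wball_closed)
  qed (use a assms(1) in auto)
  have "x \<in> A" if "x \<in> V" for x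
  proof -
    have "(x \<otimes> inv a) \<otimes> a \<in> A" using * in_some_wball[of "x \<otimes> inv a"] that a assms(1) by blast
    moreover have "(x \<otimes> inv a) \<otimes> a = x" using that a assms(1) by auto
    ultimately show ?thesis by simp
  qed
  then show ?thesis using assms(1) by auto
qed

lemma exit_finite_set:
  assumes "infinite V" "finite A" "A \<subseteq> V" "A \<noteq> {}"
  shows "\<exists>a\<in>A. \<exists>s\<in>S. s \<otimes> a \<notin> A"
  using S_closed_subset_trivial[of A] assms by metis

lemma connected_V: "connected_graph V E"
  unfolding connected_graph_def
proof (intro ballI)
  fix x y assume xy: "x \<in> V" "y \<in> V"
  have "{z. (x, z) \<in> (adj V E)\<^sup>*} = V"
  proof (rule S_closed_subset_trivial)
    show "{z. (x, z) \<in> (adj V E)\<^sup>*} \<subseteq> V" using adj_rtrancl_closed xy(1) by fastforce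
    show "s \<otimes> a \<in> {z. (x, z) \<in> (adj V E)\<^sup>*}" if "a \<in> {z. (x, z) \<in> (adj V E)\<^sup>*}" "s \<in> S" for a s
    proof -
      have "a \<in> V" using adj_rtrancl_closed xy(1) that by fastforce
      then have "(a, s \<otimes> a) \<in> adj V E" using that by (subst adj_iff) auto
      then show ?thesis using that by auto
    qed
  qed auto
  then show "(x, y) \<in> (adj V E)\<^sup>*" using xy by auto
qed

section \<open>One-ended groups grow superlinearly\<close>

lemma component_connected:
  "u \<in> component_of A E x \<Longrightarrow> v \<in> component_of A E x \<Longrightarrow> (u, v) \<in> (adj A E)\<^sup>*"
  unfolding component_of_def using adj_rtrancl_sym[of x u A E] rtrancl_trans[of u x _ v] by simp

text \<open>The complement of a ball has only finitely many components, because by connectedness of the graph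
each of them touches the sphere of radius \<open>R + 1\<close>. The finite ones are therefore contained in a larger
ball, and all points farther out belong to the infinite component. A sphere is finite, so finitely
many connecting paths suffice, and they fit into one finite set \<open>A\<close>.\<close>

lemma one_ended_annulus:
  assumes oe: "one_ended_graph V E"
  shows "\<exists>R1>R. \<exists>A. finite A \<and> A \<subseteq> V - wball R \<and>
    (\<forall>u\<in>V. \<forall>v\<in>V. len u = R1 \<and> len v = R1 \<longrightarrow> u \<in> A \<and> (u, v) \<in> (adj A E)\<^sup>*)"
proof -
  let ?F = "wball R"
  let ?C = "component_of (V - ?F) E"
  have "\<exists>!C. C \<in> graph_components (V - ?F) E \<and> infinite C"
    using oe[unfolded one_ended_graph_def, rule_format, of ?F] wball_carrier by simp
  then obtain x0 where x0: "x0 \<in> V - ?F" "infinite (?C x0)"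
    and uniq: "\<And>y. y \<in> V - ?F \<Longrightarrow> infinite (?C y) \<Longrightarrow> ?C y = ?C x0"
    unfolding graph_components_def by blast
  have self: "y \<in> ?C y" for y unfolding component_of_def by simp
  \<comment> \<open>The union of the finite components, each of which contains a point of the sphere of radius R + 1.\<close>
  define D where "D = (\<Union>u\<in>{u \<in> wball (R + 1) - ?F. finite (?C u)}. ?C u)"
  have fin_D: "finite D" 
    unfolding D_def by (rule finite_UN_I[OF finite_subset[OF _ finite_wball[of "R + 1"]]]) blast+
  have D_sub: "D \<subseteq> V"
  proof
    fix y assume "y \<in> D"
    then obtain u where "u \<in> wball (R + 1)" "u \<notin> ?F" "(u, y) \<in> (adj (V - ?F) E)\<^sup>*"
      unfolding D_def component_of_def by auto
    then show "y \<in> V" using adj_rtrancl_closed[of u y "V - ?F" E] wball_closed[of u "R + 1"] by blast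
  qed
  have D: "y \<in> D" if y: "y \<in> V - ?F" "y \<notin> ?C x0" for y
  proof -
    have "finite (?C y)" using uniq[OF y(1)] self[of y] y(2) by blast
    have "(y, \<one>) \<in> (adj V E)\<^sup>*" using connected_V y(1) by (auto simp: connected_graph_def)
    moreover have "\<one> \<notin> ?C y"
      using adj_rtrancl_closed[of y \<one> "V - ?F" E] y(1) unfolding component_of_def by auto
    ultimately obtain u v where uv: "u \<in> ?C y" "(u, v) \<in> adj V E" "v \<notin> ?C y"
      using rtrancl_exits[of y \<one> _ "?C y"] self[of y] by metis
    have u: "u \<in> V - ?F" using uv(1) adj_rtrancl_closed[of y u "V - ?F" E] y(1) unfolding component_of_def by auto
    have "v \<in> ?F"
    proof (rule ccontr)
      assume "v \<notin> ?F"
      then have "(u, v) \<in> adj (V - ?F) E" using uv u by (auto simp: adj_def)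
      then show False using uv(1,3) unfolding component_of_def by (auto dest: rtrancl_into_rtrancl)
    qed
    moreover obtain s where s: "s \<in> S" "u = s \<otimes> v"
      using uv(2) adj_sym[of V E] adj_iff[of V v u] by (auto simp: sym_def)
    ultimately have "u \<in> wball (R + 1)" using S_mult_wball[of s v R] by simp
    moreover have "?C u = ?C y"
      using uv(1) unfolding component_of_def by (auto intro: rtrancl_trans dest: adj_rtrancl_sym)
    ultimately show "y \<in> D" unfolding D_def using \<open>finite (?C y)\<close> u self[of y]
      by (intro UN_I[of u]) auto
  qed
  obtain n where n: "R \<le> n" "D \<subseteq> wball n" using finite_subset_wball[OF fin_D D_sub] by blast
  define R1 where "R1 = n + 1"
  define Sph where "Sph = {u \<in> V. len u = R1}"
  have Sph_sub: "Sph \<subseteq> wball R1" by (auto simp: Sph_def wball_eq)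
  have in_C: "u \<in> ?C x0" "u \<in> V - ?F" if "u \<in> Sph" for u
  proof -
    have u: "u \<in> V" "len u = n + 1" using that by (auto simp: Sph_def R1_def)
    then have "u \<notin> wball n" "u \<notin> wball R" using n(1) by (auto simp: wball_eq)
    then show "u \<in> V - ?F" using u by auto
    then show "u \<in> ?C x0" using D n(2) \<open>u \<notin> wball n\<close> by blast
  qed
  have "\<exists>B. finite B \<and> B \<subseteq> V - ?F \<and> u \<in> B \<and> (u, v) \<in> (adj B E)\<^sup>*" if "u \<in> Sph" "v \<in> Sph" for u v
    using component_connected[OF in_C(1)[OF that(1)] in_C(1)[OF that(2)]] in_C(2)[OF that(1)]
    by (rule path_within_finite_set)
  then obtain B where B: "\<And>u v. u \<in> Sph \<Longrightarrow> v \<in> Sph \<Longrightarrow> finite (B u v) \<and> B u v \<subseteq> V - ?F \<and> u \<in> B u v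
      \<and> (u, v) \<in> (adj (B u v) E)\<^sup>*" by metis
  define A where "A = (\<Union>u\<in>Sph. \<Union>v\<in>Sph. B u v)"
  have "finite Sph" using Sph_sub finite_subset finite_wball by blast
  then have "finite A" "A \<subseteq> V - ?F" unfolding A_def using B by blast+
  moreover have "u \<in> A \<and> (u, v) \<in> (adj A E)\<^sup>*" if "u \<in> Sph" "v \<in> Sph" for u v
  proof -
    have "B u v \<subseteq> A" using that unfolding A_def by blast
    then show ?thesis using B[OF that] adj_rtrancl_mono[of u v "B u v" E A] by blast
  qed
  ultimately show ?thesis using n(1) unfolding Sph_def
    by (intro exI[of _ R1] conjI exI[of _ A]) (auto simp: R1_def)
qed

text \<open>An intermediate point of a geodesic from \<open>x\<close> towards the identity has the expected length: the two
estimates are the triangle inequalities along \<open>d\<close> and along \<open>c\<close>. The next lemma does the same for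
geodesics that lead away from the identity.\<close>

lemma geodesic_down:
  assumes "c \<in> V" "d \<in> V" "x \<in> V" "len (c \<otimes> d) = len c + len d"
    "len (c \<otimes> d \<otimes> x) + len (c \<otimes> d) = len x"
  shows "len (d \<otimes> x) + len d = len x"
proof -
  have "len x \<le> len d + len (d \<otimes> x)" using len_mult[of "inv d" "d \<otimes> x"] assms by simp
  moreover have "len (d \<otimes> x) \<le> len c + len (c \<otimes> d \<otimes> x)"
    using len_mult[of "inv c" "c \<otimes> d \<otimes> x"] assms by (simp add: m_assoc)
  ultimately show ?thesis using assms by linarith
qed

lemma geodesic_up:
  assumes "c \<in> V" "d \<in> V" "x \<in> V" "len (c \<otimes> d) = len c + len d"
    "len (c \<otimes> d \<otimes> x) = len x + len (c \<otimes> d)"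
  shows "len (d \<otimes> x) = len x + len d"
proof -
  have "len (c \<otimes> d \<otimes> x) \<le> len c + len (d \<otimes> x)" using len_mult[of c "d \<otimes> x"] assms by (simp add: m_assoc)
  moreover have "len (d \<otimes> x) \<le> len d + len x" using len_mult assms by simp
  ultimately show ?thesis using assms by linarith
qed

text \<open>The hypotheses on \<open>a\<close> and \<open>b\<close> say that \<open>x\<close> is the midpoint of a geodesic of length \<open>2 R\<close> which
points towards the identity. Given \<open>k\<close> points within distance \<open>R\<close> of \<open>x\<close> on the sphere about the
identity through \<open>x\<close>, follow the geodesic in both directions to a larger distance \<open>R1\<close> and join the two
points reached by a path that stays outside the ball of radius \<open>R\<close> about \<open>x\<close>. These points lie on
different sides of the sphere, so the path meets it, in a point that is new. The radius depends on
\<open>k\<close> only because everything is the translate by \<open>x\<close> of a configuration about the identity.\<close>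

lemma level_set_large:
  assumes oe: "one_ended_graph V E"
  shows "\<exists>R. \<forall>x\<in>V. \<forall>a\<in>V. \<forall>b\<in>V. len a = R \<and> len b = R \<and> len (a \<otimes> x) + R = len x \<and>
    len (b \<otimes> x) = len x + R \<longrightarrow> k \<le> card {y \<in> wball R. len (y \<otimes> x) = len x}"
proof (induction k)
  case 0
  show ?case by simp
next
  case (Suc k)
  then obtain R where IH: "\<And>x a b. x \<in> V \<Longrightarrow> a \<in> V \<Longrightarrow> b \<in> V \<Longrightarrow> len a = R \<Longrightarrow> len b = R \<Longrightarrow>
    len (a \<otimes> x) + R = len x \<Longrightarrow> len (b \<otimes> x) = len x + R \<Longrightarrow> k \<le> card {y \<in> wball R. len (y \<otimes> x) = len x}"
    by blast
  obtain R1 A where R1: "R < R1" and A: "finite A" "A \<subseteq> V - wball R"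
    and path: "\<And>u v. u \<in> V \<Longrightarrow> v \<in> V \<Longrightarrow> len u = R1 \<Longrightarrow> len v = R1 \<Longrightarrow> u \<in> A \<and> (u, v) \<in> (adj A E)\<^sup>*"
    using one_ended_annulus[OF oe, of R] by blast
  obtain R2 where R2: "R1 \<le> R2" "A \<subseteq> wball R2" using finite_subset_wball[of A R1] A by blast
  show ?case
  proof (intro exI[of _ R2] ballI impI, elim conjE)
    fix x a b assume V: "x \<in> V" "a \<in> V" "b \<in> V" and len: "len a = R2" "len b = R2"
      and geo: "len (a \<otimes> x) + R2 = len x" "len (b \<otimes> x) = len x + R2"
    have "len a = (R2 - R1) + R1" using len R2 by simp
    then obtain a2 a1 where a: "a2 \<in> V" "a1 \<in> V" "a = a2 \<otimes> a1" "len a2 = R2 - R1" "len a1 = R1"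
      by (rule len_factor[OF V(2)])
    have "len b = (R2 - R1) + R1" using len R2 by simp
    then obtain b2 b1 where b: "b2 \<in> V" "b1 \<in> V" "b = b2 \<otimes> b1" "len b2 = R2 - R1" "len b1 = R1"
      by (rule len_factor[OF V(3)])
    have a1: "len (a1 \<otimes> x) + R1 = len x"
      using geodesic_down[OF a(1,2) V(1)] a geo len R2 by simp
    have b1: "len (b1 \<otimes> x) = len x + R1"
      using geodesic_up[OF b(1,2) V(1)] b geo len R2 by simp
    have "len a1 = (R1 - R) + R" using a R1 by simp
    then obtain c a0 where c: "c \<in> V" "a0 \<in> V" "a1 = c \<otimes> a0" "len c = R1 - R" "len a0 = R"
      by (rule len_factor[OF a(2)])
    have "len b1 = (R1 - R) + R" using b R1 by simp
    then obtain d b0 where d: "d \<in> V" "b0 \<in> V" "b1 = d \<otimes> b0" "len d = R1 - R" "len b0 = R"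
      by (rule len_factor[OF b(2)])
    have a0: "len (a0 \<otimes> x) + R = len x"
      using geodesic_down[OF c(1,2) V(1)] c a1 a R1 by simp
    have b0: "len (b0 \<otimes> x) = len x + R"
      using geodesic_up[OF d(1,2) V(1)] d b1 b R1 by simp
    have k: "k \<le> card {y \<in> wball R. len (y \<otimes> x) = len x}"
      using IH[OF V(1) c(2) d(2) c(5) d(5) a0 b0] .
    have p: "(a1, b1) \<in> (adj A E)\<^sup>*" "a1 \<in> A" using path a b by auto
    have AV: "A \<subseteq> V" using A by blast
    have "\<exists>z. (a1, z) \<in> (adj A E)\<^sup>* \<and> len (z \<otimes> x) = len x"
    proof (rule path_attains_level[OF p(1)])
      show "len (v \<otimes> x) \<le> len (u \<otimes> x) + 1" if uv: "(u, v) \<in> adj A E" for u v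
      proof -
        obtain s where s: "s \<in> S" "v = s \<otimes> u" "u \<in> V" using uv adj_iff[OF AV] AV by blast
        then have "v \<otimes> x = s \<otimes> (u \<otimes> x)" using V by (simp add: m_assoc)
        then show ?thesis using len_step[of s "u \<otimes> x"] s V by simp
      qed
    qed (use a1 b1 in auto)
    then obtain z where z: "(a1, z) \<in> (adj A E)\<^sup>*" "len (z \<otimes> x) = len x" by blast
    have zA: "z \<in> A" using adj_rtrancl_closed[OF z(1)] p(2) by blast
    have "wball R \<subseteq> wball R2" using wball_mono R1 R2 by simp
    then have "insert z {y \<in> wball R. len (y \<otimes> x) = len x} \<subseteq> {y \<in> wball R2. len (y \<otimes> x) = len x}"
      using z zA R2 by auto
    then have "card (insert z {y \<in> wball R. len (y \<otimes> x) = len x}) \<le> card {y \<in> wball R2. len (y \<otimes> x) = len x}"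
      by (intro card_mono) auto
    moreover have "z \<notin> wball R" using zA A by auto
    ultimately show "Suc k \<le> card {y \<in> wball R2. len (y \<otimes> x) = len x}" using k by simp
  qed
qed

text \<open>Every sphere of radius at least \<open>R\<close> contains the midpoint of a geodesic of length \<open>2 R\<close> pointing towards
the identity: truncate an element of length \<open>R + t\<close>.\<close>

lemma sphere_large:
  assumes oe: "one_ended_graph V E" and inf: "infinite V"
  shows "\<exists>R. \<forall>t\<ge>R. k \<le> card {g \<in> V. len g = t}"
proof -
  obtain R where R: "\<And>x a b. x \<in> V \<Longrightarrow> a \<in> V \<Longrightarrow> b \<in> V \<Longrightarrow> len a = R \<Longrightarrow> len b = R \<Longrightarrow>
    len (a \<otimes> x) + R = len x \<Longrightarrow> len (b \<otimes> x) = len x + R \<Longrightarrow> k \<le> card {y \<in> wball R. len (y \<otimes> x) = len x}"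
    using level_set_large[OF oe, of k] by blast
  have "k \<le> card {g \<in> V. len g = t}" if "R \<le> t" for t
  proof -
    obtain z where z: "z \<in> V" "len z = R + t" using ex_len[OF inf] by blast
    obtain b x where x: "b \<in> V" "x \<in> V" "z = b \<otimes> x" "len b = R" "len x = t"
      by (rule len_factor[OF z])
    have "len x = R + (t - R)" using x that by simp
    then obtain c w where w: "c \<in> V" "w \<in> V" "x = c \<otimes> w" "len c = R" "len w = t - R"
      by (rule len_factor[OF x(2)])
    have "k \<le> card {y \<in> wball R. len (y \<otimes> x) = len x}"
    proof (rule R)
      show "len (inv c \<otimes> x) + R = len x" using w that x(5) by (simp add: inv_mult_cancel)
      show "len (b \<otimes> x) = len x + R" using x z by simp
    qed (use x w in auto)
    also have "\<dots> = card ((\<lambda>y. y \<otimes> x) ` {y \<in> wball R. len (y \<otimes> x) = len x})"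
      using x(2) wball_closed by (intro card_image[symmetric] inj_onI) auto
    also have "\<dots> \<le> card {g \<in> V. len g = t}"
    proof (rule card_mono)
      have "{g \<in> V. len g = t} \<subseteq> wball t" by (auto simp: wball_eq)
      then show "finite {g \<in> V. len g = t}" using finite_subset finite_wball by blast
    qed (use x wball_closed in auto)
    finally show ?thesis .
  qed
  then show ?thesis by blast
qed

lemma wball_superlinear:
  assumes "one_ended_graph V E" and "infinite V"
  shows "\<exists>R. \<forall>r\<ge>R. k * r \<le> card (wball (2 * r))"
proof -
  obtain R where R: "\<And>t. R \<le> t \<Longrightarrow> k \<le> card {g \<in> V. len g = t}" using sphere_large[OF assms] by blast
  have *: "k * j \<le> card (wball (R + j))" for j
  proof (induction j)
    case (Suc j)
    let ?Sph = "{g \<in> V. len g = R + Suc j}"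
    have eq: "wball (R + Suc j) = wball (R + j) \<union> ?Sph" by (auto simp: wball_eq)
    have "finite ?Sph" using eq finite_wball[of "R + Suc j"] by (metis finite_Un)
    then have "card (wball (R + Suc j)) = card (wball (R + j)) + card ?Sph"
      unfolding eq by (intro card_Un_disjoint finite_wball) (auto simp: wball_eq)
    then show ?case using Suc R[of "R + Suc j"] by simp
  qed simp
  have "k * r \<le> card (wball (2 * r))" if "R \<le> r" for r
    using *[of r] card_mono[OF finite_wball wball_mono[of "R + r" "2 * r"]] that by simp
  then show ?thesis by blast
qed

lemma wball_change_generators:
  assumes "marked_group G S'"
  shows "\<exists>L\<ge>1. \<forall>n. marked_group.wball G S' n \<subseteq> wball (L * n)"
proof -
  interpret S': marked_group G S' by fact
  obtain L where L: "1 \<le> L" "S' \<subseteq> wball L"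
    using finite_subset_wball[OF S'.finite_S S'.S_carrier] by blast
  have "S'.wball n \<subseteq> wball (L * n)" for n
  proof (induction n)
    case (Suc n)
    have "wball (L * n) \<subseteq> wball (L * Suc n)" by (intro wball_mono) simp
    then show ?case using Suc wball_mult[of _ L _ "L * n"] L(2) by fastforce
  qed simp
  then show ?thesis using L by blast
qed

text \<open>The comparison with \<open>2 * r + 1\<close> is the form in which growth enters: \<open>2 * r + 1\<close> is the price
for attaching one ball of radius \<open>r\<close> to a skeleton. The generating set that witnesses
one-endedness changes the radius by a bounded factor only.\<close>

lemma one_ended_group_growth:
  assumes "one_ended_group G" and inf: "infinite V"
  shows "\<exists>r. M * (2 * r + 1) \<le> card (wball r)"
proof -
  obtain S' where S': "symmetric_generating_set G S'" "one_ended_graph V (cayley_edges G S')"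
    using assms by (auto simp: one_ended_group_def)
  interpret S': marked_group G S' by unfold_locales fact
  obtain L where L: "1 \<le> L" "\<And>n. S'.wball n \<subseteq> wball (L * n)"
    using wball_change_generators[of S'] S'.marked_group_axioms by blast
  \<comment> \<open>The factor 5 absorbs 2 * (2 * L * r) + 1, which is at most 5 * L * r for L * r at least 1.\<close>
  obtain R where R: "\<And>r. R \<le> r \<Longrightarrow> (5 * L * M) * r \<le> card (S'.wball (2 * r))"
    using S'.wball_superlinear[OF S'(2) inf] by blast
  define r where "r = R + 1"
  have "1 \<le> L * r" using L by (simp add: r_def)
  then have "M * (2 * (L * (2 * r)) + 1) \<le> M * (5 * (L * r))" by (intro mult_left_mono) auto
  also have "\<dots> = (5 * L * M) * r" by simp
  also have "\<dots> \<le> card (S'.wball (2 * r))" by (rule R) (simp add: r_def)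
  also have "\<dots> \<le> card (wball (L * (2 * r)))" by (intro card_mono finite_wball L)
  finally show ?thesis by blast
qed

section \<open>Amenable groups have connected sets with small rim\<close>

text \<open>The inner vertex boundary. In contrast to the outer boundary it is additive over the connected
components of a set.\<close>

definition rim :: "'a set \<Rightarrow> 'a set" where
  "rim A = {a \<in> A. \<exists>s\<in>S. s \<otimes> a \<notin> A}"

lemma rim_subset: "rim A \<subseteq> A"
  by (auto simp: rim_def)

lemma finite_rim [simp]: "finite A \<Longrightarrow> finite (rim A)"
  using finite_subset rim_subset by blast

lemma rim_nonempty:
  assumes "infinite V" "finite A" "A \<subseteq> V" "A \<noteq> {}"
  shows "rim A \<noteq> {}"
  using exit_finite_set[OF assms] by (auto simp: rim_def)

text \<open>A single generator moves points of \<open>A\<close> injectively into the outer boundary, and the number of points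
moved out of \<open>A\<close> is subadditive in the group element. This makes small boundaries independent of
the generating set.\<close>

lemma displaced_le_vertex_boundary:
  assumes "g \<in> V"
  shows "\<exists>L. \<forall>A. finite A \<and> A \<subseteq> V \<longrightarrow> card {a \<in> A. g \<otimes> a \<notin> A} \<le> L * card (vertex_boundary V E A)"
proof -
  have fin_bd: "finite (vertex_boundary V E A)" if "finite A" "A \<subseteq> V" for A
  proof (rule finite_subset)
    show "vertex_boundary V E A \<subseteq> (\<lambda>(s, a). s \<otimes> a) ` (S \<times> A)"
      by (auto simp: vertex_boundary_def adj_iff image_iff)
    show "finite ((\<lambda>(s, a). s \<otimes> a) ` (S \<times> A))" using that finite_S by auto
  qed
  have gen: "card {a \<in> A. s \<otimes> a \<notin> A} \<le> card (vertex_boundary V E A)"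
    if s: "s \<in> S" and A: "finite A" "A \<subseteq> V" for s A
  proof (rule card_inj_on_le[OF _ _ fin_bd[OF A]])
    show "inj_on (\<lambda>a. s \<otimes> a) {a \<in> A. s \<otimes> a \<notin> A}" using s A by (intro inj_on_subset[OF inj_on_cmult[of s]]) auto
    show "(\<lambda>a. s \<otimes> a) ` {a \<in> A. s \<otimes> a \<notin> A} \<subseteq> vertex_boundary V E A"
    proof
      fix b assume "b \<in> (\<lambda>a. s \<otimes> a) ` {a \<in> A. s \<otimes> a \<notin> A}"
      then obtain a where a: "a \<in> A" "b = s \<otimes> a" "b \<notin> A" by blast
      then have "b \<in> V" "(a, b) \<in> adj V E" using s A by (auto simp: adj_iff subsetD)
      then show "b \<in> vertex_boundary V E A" using a unfolding vertex_boundary_def by blast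
    qed
  qed
  have "\<exists>L. \<forall>A. finite A \<and> A \<subseteq> V \<longrightarrow> card {a \<in> A. g \<otimes> a \<notin> A} \<le> L * card (vertex_boundary V E A)"
    if "g \<in> generate G S"
    using that
  proof (induction rule: generate.induct)
    case one
    have "{a \<in> A. \<one> \<otimes> a \<notin> A} = {}" if "A \<subseteq> V" for A using that by auto
    then show ?case by (intro exI[of _ 0]) auto
  next
    case (incl h)
    then show ?case using gen by (intro exI[of _ 1]) auto
  next
    case (inv h)
    then show ?case using gen[OF inv_S] by (intro exI[of _ 1]) auto
  next
    case (eng g h)
    have V: "g \<in> V" "h \<in> V" using eng gen_S by auto
    from eng.IH(1) obtain L1 where
      L1: "\<forall>A. finite A \<and> A \<subseteq> V \<longrightarrow> card {a \<in> A. g \<otimes> a \<notin> A} \<le> L1 * card (vertex_boundary V E A)" ..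
    from eng.IH(2) obtain L2 where
      L2: "\<forall>A. finite A \<and> A \<subseteq> V \<longrightarrow> card {a \<in> A. h \<otimes> a \<notin> A} \<le> L2 * card (vertex_boundary V E A)" ..
    have "card {a \<in> A. g \<otimes> h \<otimes> a \<notin> A} \<le> (L1 + L2) * card (vertex_boundary V E A)"
      if A: "finite A" "A \<subseteq> V" for A
    proof -
      let ?B = "{a \<in> A. h \<otimes> a \<in> A \<and> g \<otimes> (h \<otimes> a) \<notin> A}"
      have "card {a \<in> A. g \<otimes> h \<otimes> a \<notin> A} \<le> card ({a \<in> A. h \<otimes> a \<notin> A} \<union> ?B)"
        using A V by (intro card_mono) (auto simp: m_assoc subsetD)
      also have "\<dots> \<le> card {a \<in> A. h \<otimes> a \<notin> A} + card ?B" by (rule card_Un_le)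
      also have "card ?B \<le> card {a \<in> A. g \<otimes> a \<notin> A}"
      proof (rule card_inj_on_le)
        show "inj_on (\<lambda>a. h \<otimes> a) ?B" using V A by (intro inj_on_subset[OF inj_on_cmult[of h]]) auto
      qed (use A in auto)
      finally show ?thesis using L1[rule_format, of A] L2[rule_format, of A] A by (simp add: algebra_simps)
    qed
    then show ?case by blast
  qed
  then show ?thesis using assms gen_S by simp
qed

lemma rim_le_vertex_boundary:
  assumes "marked_group G S'"
  shows "\<exists>L. \<forall>A. finite A \<and> A \<subseteq> V \<longrightarrow> card (rim A) \<le> L * card (vertex_boundary V (cayley_edges G S') A)"
proof -
  interpret S': marked_group G S' by fact
  let ?b = "\<lambda>A. card (vertex_boundary V (cayley_edges G S') A)"
  have "\<forall>s\<in>S. \<exists>L. \<forall>A. finite A \<and> A \<subseteq> V \<longrightarrow> card {a \<in> A. s \<otimes> a \<notin> A} \<le> L * ?b A"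
    by (intro ballI S'.displaced_le_vertex_boundary) simp
  then obtain L where L: "\<And>s A. s \<in> S \<Longrightarrow> finite A \<Longrightarrow> A \<subseteq> V \<Longrightarrow> card {a \<in> A. s \<otimes> a \<notin> A} \<le> L s * ?b A"
    by (auto dest!: bchoice)
  have "card (rim A) \<le> (\<Sum>s\<in>S. L s) * ?b A" if A: "finite A" "A \<subseteq> V" for A
  proof -
    have "rim A = (\<Union>s\<in>S. {a \<in> A. s \<otimes> a \<notin> A})" by (auto simp: rim_def)
    then have "card (rim A) \<le> (\<Sum>s\<in>S. card {a \<in> A. s \<otimes> a \<notin> A})"
      by (simp only:) (rule card_UN_le[OF finite_S])
    also have "\<dots> \<le> (\<Sum>s\<in>S. L s * ?b A)" by (intro sum_mono L A)
    finally show ?thesis by (simp add: sum_distrib_right)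
  qed
  then show ?thesis by blast
qed

lemma amenable_small_rim:
  assumes "amenable_group G" and "(\<epsilon>::real) > 0"
  shows "\<exists>A. finite A \<and> A \<noteq> {} \<and> A \<subseteq> V \<and> real (card (rim A)) \<le> \<epsilon> * card A"
proof -
  obtain S' where S': "symmetric_generating_set G S'" "amenable_graph V (cayley_edges G S')"
    using assms by (auto simp: amenable_group_def)
  interpret S': marked_group G S' by unfold_locales fact
  let ?b = "\<lambda>A. card (vertex_boundary V (cayley_edges G S') A)"
  obtain L where L: "\<And>A. finite A \<Longrightarrow> A \<subseteq> V \<Longrightarrow> card (rim A) \<le> L * ?b A"
    using rim_le_vertex_boundary[of S'] S'.marked_group_axioms by blast
  let ?X = "{real (?b W) / real (card W) | W. W \<noteq> {} \<and> W \<subseteq> V \<and> finite W}"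
  have "Inf ?X = 0" using S'(2) by (simp add: amenable_graph_def)
  moreover have "0 < \<epsilon> / (real L + 1)" using assms(2) by simp
  moreover have "{\<one>} \<noteq> {} \<and> {\<one>} \<subseteq> V \<and> finite {\<one>}" by simp
  then have "?X \<noteq> {}" by blast
  ultimately obtain x where x: "x \<in> ?X" "x < \<epsilon> / (real L + 1)" using cInf_lessD[of ?X "\<epsilon> / (real L + 1)"] by auto
  then obtain W where W: "W \<noteq> {}" "W \<subseteq> V" "finite W" "real (?b W) / real (card W) < \<epsilon> / (real L + 1)" by blast
  then have "0 < card W" by (simp add: card_gt_0_iff)
  then have b: "real (?b W) * (real L + 1) \<le> \<epsilon> * card W" using W(4) by (simp add: field_simps)
  have "real (card (rim W)) \<le> real (L * ?b W)" using L[OF W(3,2)] of_nat_le_iff by blast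
  also have "\<dots> \<le> real (?b W) * (real L + 1)" by (simp add: algebra_simps)
  also note b
  finally show ?thesis using W by (intro exI[of _ W]) simp
qed

text \<open>A set with minimal cardinality among those with small relative rim is connected: if it split into
two parts without edges between them, the rims would add up, so one of the parts would do as well.\<close>

lemma amenable_connected_small_rim:
  assumes "amenable_group G" and "(\<epsilon>::real) > 0"
  shows "\<exists>A. finite A \<and> A \<noteq> {} \<and> A \<subseteq> V \<and> connected_graph A E \<and> real (card (rim A)) \<le> \<epsilon> * card A"
proof -
  let ?P = "\<lambda>A. finite A \<and> A \<noteq> {} \<and> A \<subseteq> V \<and> real (card (rim A)) \<le> \<epsilon> * card A"
  obtain A where A: "?P A" and least: "\<And>B. ?P B \<Longrightarrow> card A \<le> card B"
    using ex_has_least_nat[of ?P _ card] amenable_small_rim[OF assms] by metis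
  have "connected_graph A E"
    unfolding connected_graph_def
  proof (intro ballI, rule ccontr)
    fix x y assume xy: "x \<in> A" "y \<in> A" "(x, y) \<notin> (adj A E)\<^sup>*"
    define B where "B = {z. (x, z) \<in> (adj A E)\<^sup>*}"
    define C where "C = A - B"
    have B: "B \<subseteq> A" "x \<in> B" "y \<in> C" using xy adj_rtrancl_closed by (fastforce simp: B_def C_def)+
    have cross: "b \<in> B \<longleftrightarrow> c \<in> B" if "b \<in> A" "c \<in> A" "s \<in> S" "c = s \<otimes> b" for b c s
    proof -
      have "(b, c) \<in> adj A E" using that A by (subst adj_iff) auto
      moreover from this have "(c, b) \<in> adj A E" using adj_sym by (metis symE)
      ultimately show ?thesis unfolding B_def by (auto intro: rtrancl_into_rtrancl)
    qed
    have rims: "rim B \<subseteq> rim A \<inter> B" "rim C \<subseteq> rim A \<inter> C"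
      using cross B(1) unfolding rim_def C_def by blast+
    have fin: "finite A" "finite B" "finite C" using A B(1) finite_subset by (auto simp: C_def)
    have "card (rim B) + card (rim C) = card (rim B \<union> rim C)"
      using rims fin by (intro card_Un_disjoint[symmetric]) (auto simp: C_def)
    also have "\<dots> \<le> card (rim A)" using rims fin by (intro card_mono) auto
    finally have 1: "real (card (rim B)) + real (card (rim C)) \<le> real (card (rim A))" by linarith
    have cA: "card A = card B + card C" using B(1) fin by (simp add: C_def card_Diff_subset card_mono)
    have "0 < card B" "0 < card C" using B fin by (auto simp: card_gt_0_iff)
    then have "card B < card A" "card C < card A" using cA by auto
    then have "\<not> ?P B" "\<not> ?P C" using least by (meson leD)+
    then have "real (card (rim B)) > \<epsilon> * card B" "real (card (rim C)) > \<epsilon> * card C"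
      using A B fin by (auto simp: C_def not_le)
    with 1 A show False unfolding cA by (simp add: algebra_simps)
  qed
  then show ?thesis using A by blast
qed

section \<open>Cheap skeletons of connected sets\<close>

abbreviation translate :: "'a set \<Rightarrow> 'a \<Rightarrow> 'a set" where
  "translate A x \<equiv> (\<lambda>a. a \<otimes> x) ` A"

lemma inj_translate: "x \<in> V \<Longrightarrow> A \<subseteq> V \<Longrightarrow> inj_on (\<lambda>a. a \<otimes> x) A"
  by (rule inj_on_subset[OF inj_on_multc])

lemma card_translate: "x \<in> V \<Longrightarrow> A \<subseteq> V \<Longrightarrow> card (translate A x) = card A"
  by (intro card_image inj_translate)

lemma translate_carrier: "x \<in> V \<Longrightarrow> A \<subseteq> V \<Longrightarrow> translate A x \<subseteq> V"
  by auto

lemma connected_translate: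
  assumes x: "x \<in> V" and A: "A \<subseteq> V" "connected_graph A E"
  shows "connected_graph (translate A x) E"
proof -
  have step: "(u \<otimes> x, v \<otimes> x) \<in> adj (translate A x) E" if uv: "(u, v) \<in> adj A E" for u v
  proof -
    obtain s where s: "s \<in> S" "v = s \<otimes> u" "u \<in> A" "v \<in> A" by (rule adjE[OF uv A(1)])
    then have vx: "v \<otimes> x = s \<otimes> (u \<otimes> x)" using x A by (auto simp: m_assoc subsetD)
    have "u \<otimes> x \<in> translate A x" "v \<otimes> x \<in> translate A x" using s by auto
    then show ?thesis unfolding vx using s(1) by (intro adjI translate_carrier x A)
  qed
  have "(u \<otimes> x, v \<otimes> x) \<in> (adj (translate A x) E)\<^sup>*" if "(u, v) \<in> (adj A E)\<^sup>*" for u v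
    using that by (induction rule: rtrancl_induct) (auto intro: rtrancl_into_rtrancl step)
  then show ?thesis using A(2) unfolding connected_graph_def by blast
qed

lemma rim_translate:
  assumes "x \<in> V" "A \<subseteq> V"
  shows "rim (translate A x) \<subseteq> translate (rim A) x"
proof
  fix b assume "b \<in> rim (translate A x)"
  then obtain a s where a: "a \<in> A" "b = a \<otimes> x" "s \<in> S" "s \<otimes> (a \<otimes> x) \<notin> translate A x"
    by (auto simp: rim_def)
  then have "s \<otimes> a \<otimes> x \<notin> translate A x" using assms by (auto simp: m_assoc subsetD)
  then have "s \<otimes> a \<notin> A" by blast
  then show "b \<in> translate (rim A) x" using a by (auto simp: rim_def)
qed

lemma rim_Un: "rim (A \<union> B) \<subseteq> rim A \<union> rim B"
  by (auto simp: rim_def)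

text \<open>The word length takes every value between \<open>0\<close> and its maximum on a connected set that contains
the identity.\<close>

lemma connected_diameter:
  assumes "finite A" "A \<subseteq> V" "connected_graph A E" "\<one> \<in> A"
  shows "A \<subseteq> wball (card A)"
proof
  fix v assume v: "v \<in> A"
  have "\<exists>z. (\<one>, z) \<in> (adj A E)\<^sup>* \<and> len z = t" if "t \<le> len v" for t
  proof (rule path_attains_level[where f = len])
    show "(\<one>, v) \<in> (adj A E)\<^sup>*" using assms v by (auto simp: connected_graph_def)
    show "len b \<le> len a + 1" if ab: "(a, b) \<in> adj A E" for a b
    proof -
      obtain s where "s \<in> S" "b = s \<otimes> a" "a \<in> A" by (rule adjE[OF ab assms(2)])
      then show ?thesis using len_step[of s a] assms(2) by auto
    qed
  qed (use that in auto)
  then have "{..len v} \<subseteq> len ` A" using adj_rtrancl_closed[OF _ assms(4)] by (auto simp: image_iff) metis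
  then have "card {..len v} \<le> card A" using assms(1) by (meson card_image_le card_mono finite_imageI le_trans)
  then show "v \<in> wball (card A)" using v assms(2) by (auto simp: wball_eq)
qed

text \<open>A path that starts in \<open>A\<close> and ends outside leaves \<open>A\<close> through the rim; so thickening by \<open>r\<close> adds at
most the \<open>r\<close>-balls about the rim.\<close>

lemma rim_thickening:
  assumes A: "A \<subseteq> V" and x: "x \<in> A" and g: "g \<in> wball r"
  shows "g \<otimes> x \<in> A \<union> (\<lambda>(h, y). h \<otimes> y) ` (wball r \<times> rim A)"
  using g
proof (induction r arbitrary: g)
  case 0
  then show ?case using A x by auto
next
  case (Suc r)
  show ?case
  proof (cases "g \<in> wball r")
    case True
    have "wball r \<times> rim A \<subseteq> wball (Suc r) \<times> rim A" by auto
    then show ?thesis using Suc.IH[OF True] by blast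
  next
    case False
    then obtain s g' where g: "s \<in> S" "g' \<in> wball r" "g = s \<otimes> g'" using Suc.prems by auto
    have gx: "g \<otimes> x = s \<otimes> (g' \<otimes> x)" using g x A wball_closed by (simp add: m_assoc subsetD)
    from Suc.IH[OF g(2)] show ?thesis
    proof
      assume in_A: "g' \<otimes> x \<in> A"
      show ?thesis
      proof (cases "g \<otimes> x \<in> A")
        case False
        then have "g' \<otimes> x \<in> rim A" using in_A g(1) by (auto simp: rim_def gx)
        moreover have "s \<in> wball (Suc r)" using S_in_wball[OF g(1)] wball_mono[of "Suc 0" "Suc r"] by auto
        ultimately show ?thesis unfolding gx by blast
      qed simp
    next
      assume "g' \<otimes> x \<in> (\<lambda>(h, y). h \<otimes> y) ` (wball r \<times> rim A)"
      then obtain h y where h: "h \<in> wball r" "y \<in> rim A" "g' \<otimes> x = h \<otimes> y" by auto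
      then have "g \<otimes> x = (s \<otimes> h) \<otimes> y"
        unfolding gx using g(1) A rim_subset[of A] wball_closed by (simp add: m_assoc subset_iff)
      then show ?thesis using S_mult_wball[OF g(1) h(1)] h(2)
        by (intro UnI2 image_eqI[of _ _ "(s \<otimes> h, y)"]) auto
    qed
  qed
qed

lemma separated_card_le:
  assumes A: "finite A" "A \<subseteq> V" and N: "N \<subseteq> A"
    and sep: "\<And>x y. x \<in> N \<Longrightarrow> y \<in> N \<Longrightarrow> x \<noteq> y \<Longrightarrow> y \<otimes> inv x \<notin> wball (2 * r)"
  shows "card N * card (wball r) \<le> card A + card (wball r) * card (rim A)"
proof -
  have fin: "finite N" using A N finite_subset by blast
  have NV: "N \<subseteq> V" using A N by blast
  have "card N * card (wball r) = (\<Sum>x\<in>N. card (translate (wball r) x))"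
    using NV wball_carrier by (simp add: card_translate subset_iff)
  also have "\<dots> = card (\<Union>x\<in>N. translate (wball r) x)"
  proof (rule card_UN_disjoint[symmetric, OF fin])
    show "\<forall>x\<in>N. \<forall>y\<in>N. x \<noteq> y \<longrightarrow> translate (wball r) x \<inter> translate (wball r) y = {}"
    proof (intro ballI impI, rule ccontr)
      fix x y assume xy: "x \<in> N" "y \<in> N" "x \<noteq> y" "translate (wball r) x \<inter> translate (wball r) y \<noteq> {}"
      then obtain g h where gh: "g \<in> wball r" "h \<in> wball r" "g \<otimes> x = h \<otimes> y" by blast
      have V: "g \<in> V" "h \<in> V" "x \<in> V" "y \<in> V" using gh xy NV wball_closed by auto
      have "y = inv h \<otimes> (g \<otimes> x)" unfolding gh(3) using V by simp
      then have "y \<otimes> inv x = inv h \<otimes> g" using V by (simp add: m_assoc)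
      moreover have "inv h \<otimes> g \<in> wball (r + r)" using gh by (intro wball_mult inv_wball)
      ultimately show False using sep[OF xy(1-3)] by (simp add: mult_2)
    qed
  qed auto
  also have "\<dots> \<le> card (A \<union> (\<lambda>(h, y). h \<otimes> y) ` (wball r \<times> rim A))"
  proof (rule card_mono)
    show "(\<Union>x\<in>N. translate (wball r) x) \<subseteq> A \<union> (\<lambda>(h, y). h \<otimes> y) ` (wball r \<times> rim A)"
      using rim_thickening[OF A(2)] N by blast
  qed (use A in auto)
  also have "\<dots> \<le> card A + card ((\<lambda>(h, y). h \<otimes> y) ` (wball r \<times> rim A))" by (rule card_Un_le)
  also have "card ((\<lambda>(h, y). h \<otimes> y) ` (wball r \<times> rim A)) \<le> card (wball r \<times> rim A)"
    using A by (intro card_image_le) auto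
  finally show ?thesis by (simp add: card_cartesian_product)
qed

lemma attach_path:
  assumes T: "finite T" "T \<subseteq> V" "connected_graph T E" and u: "u \<in> T" and g: "g \<in> wball n"
  shows "\<exists>T'. finite T' \<and> T' \<subseteq> V \<and> connected_graph T' E \<and> T \<subseteq> T' \<and> g \<otimes> u \<in> T' \<and> card T' \<le> card T + n"
proof -
  obtain P where P: "P \<subseteq> V" "finite P" "card P \<le> n + 1" "u \<in> P" "g \<otimes> u \<in> P" "connected_graph P E"
    using path_between[of u g n] u T(2) g by blast
  have "card (T \<union> P) = card (T \<union> (P - {u}))" using u by (intro arg_cong[of _ _ card]) auto
  also have "\<dots> \<le> card T + card (P - {u})" by (rule card_Un_le)
  also have "card (P - {u}) \<le> n" using P by simp
  finally show ?thesis using P T connected_graph_Un[OF T(3) P(6) u P(4)]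
    by (intro exI[of _ "T \<union> P"]) auto
qed

text \<open>Among the separated subsets of \<open>A\<close> that come with a cheap connected superset \<open>T\<close> choose one of
maximal size. If it left a point of \<open>A\<close> at distance more than \<open>2 * r\<close>, then by connectedness of \<open>A\<close>
some point would be at distance exactly \<open>2 * r + 1\<close>, and it could be added to the net at the price
of a path of that length.\<close>

lemma spanning_net:
  assumes A: "finite A" "A \<noteq> {}" "A \<subseteq> V" "connected_graph A E"
  shows "\<exists>N T. N \<subseteq> A \<and> finite T \<and> T \<subseteq> V \<and> connected_graph T E \<and> N \<subseteq> T \<and> N \<noteq> {} \<and>
    card T \<le> (2 * r + 1) * card N \<and>
    card N * card (wball r) \<le> card A + card (wball r) * card (rim A) \<and>
    (\<forall>a\<in>A. \<exists>x\<in>N. \<exists>g\<in>wball (2 * r). a = g \<otimes> x)"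
proof -
  let ?sep = "\<lambda>N. \<forall>x\<in>N. \<forall>y\<in>N. x \<noteq> y \<longrightarrow> y \<otimes> inv x \<notin> wball (2 * r)"
  let ?ok = "\<lambda>N T. finite T \<and> T \<subseteq> V \<and> connected_graph T E \<and> N \<subseteq> T \<and> card T \<le> (2 * r + 1) * card N"
  let ?P = "\<lambda>N. N \<subseteq> A \<and> N \<noteq> {} \<and> ?sep N \<and> (\<exists>T. ?ok N T)"
  obtain a0 where a0: "a0 \<in> A" using A(2) by blast
  have "?P {a0}" using a0 A(3) by (auto intro!: exI[of _ "{a0}"] simp: connected_graph_def)
  moreover have "\<forall>N. ?P N \<longrightarrow> card N < card A + 1"
    using card_mono[OF A(1)] by (simp add: less_Suc_eq_le)
  ultimately have "\<exists>N. ?P N \<and> (\<forall>N'. ?P N' \<longrightarrow> card N' \<le> card N)" by (rule ex_has_greatest_nat)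
  then obtain N where N_max: "?P N \<and> (\<forall>N'. ?P N' \<longrightarrow> card N' \<le> card N)" ..
  note N = N_max[THEN conjunct1] and max = N_max[THEN conjunct2]
  have N': "N \<subseteq> A" "N \<noteq> {}" "?sep N" by (rule N[THEN conjunct1], rule N[THEN conjunct2, THEN conjunct1],
    rule N[THEN conjunct2, THEN conjunct2, THEN conjunct1])
  from N obtain T where T: "?ok N T" by (elim exE conjE) (rule that, intro conjI)
  have finN: "finite N" using N'(1) A(1) finite_subset by blast
  have NV: "N \<subseteq> V" using N'(1) A(3) by blast
  let ?U = "{a \<in> A. \<exists>x\<in>N. \<exists>g\<in>wball (2 * r). a = g \<otimes> x}"
  have "A \<subseteq> ?U"
  proof (rule ccontr)
    assume "\<not> A \<subseteq> ?U"
    then obtain y where y: "y \<in> A" "y \<notin> ?U" by blast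
    obtain x where x: "x \<in> N" using N'(2) by blast
    have self: "z \<in> ?U" if "z \<in> N" for z
    proof -
      have "z = \<one> \<otimes> z" "z \<in> A" using that NV N'(1) by auto
      then show ?thesis using that one_in_wball by blast
    qed
    have "(x, y) \<in> (adj A E)\<^sup>*" using A(4) x N'(1) y(1) unfolding connected_graph_def by blast
    then obtain a b where "(x, a) \<in> (adj A E)\<^sup>*" and ab: "a \<in> ?U" "(a, b) \<in> adj A E" "b \<notin> ?U"
      by (rule rtrancl_exits[OF _ self[OF x] y(2)])
    obtain s where s: "s \<in> S" "b = s \<otimes> a" "b \<in> A" by (rule adjE[OF ab(2) A(3)])
    obtain z g where z: "z \<in> N" "g \<in> wball (2 * r)" "a = g \<otimes> z" using ab(1) by blast
    have bz: "b = (s \<otimes> g) \<otimes> z" using s z NV wball_closed by (simp add: m_assoc subset_iff)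
    have "s \<otimes> g \<in> wball (2 * r + 1)" using S_mult_wball[OF s(1) z(2)] by simp
    then obtain T' where T': "finite T'" "T' \<subseteq> V" "connected_graph T' E" "T \<subseteq> T'" "b \<in> T'"
      "card T' \<le> card T + (2 * r + 1)"
      using attach_path[of T z "s \<otimes> g" "2 * r + 1"] T z(1) unfolding bz by blast
    have bN: "b \<notin> N" using self ab(3) by blast
    have bV: "b \<in> V" using s A by blast
    have far: "b \<otimes> inv x \<notin> wball (2 * r)" if "x \<in> N" for x
    proof
      assume "b \<otimes> inv x \<in> wball (2 * r)"
      moreover have "b = (b \<otimes> inv x) \<otimes> x" using bV that NV by (simp add: subset_iff)
      ultimately show False using ab(3) s(3) that by blast
    qed
    moreover have "x \<otimes> inv b \<notin> wball (2 * r)" if "x \<in> N" for x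
    proof
      assume "x \<otimes> inv b \<in> wball (2 * r)"
      then have "inv (x \<otimes> inv b) \<in> wball (2 * r)" by (rule inv_wball)
      then show False using far[OF that] that NV bV by (simp add: inv_mult_group subset_iff)
    qed
    ultimately have "?sep (insert b N)" using N'(3) by auto
    moreover have "?ok (insert b N) T'" using T T' bN finN by auto
    ultimately have "?P (insert b N)" using N'(1) s(3) by (intro conjI) auto
    then show False using max[rule_format, of "insert b N"] bN finN by simp
  qed
  then have net: "\<forall>a\<in>A. \<exists>x\<in>N. \<exists>g\<in>wball (2 * r). a = g \<otimes> x" by blast
  have packed: "card N * card (wball r) \<le> card A + card (wball r) * card (rim A)"
    using N' by (intro separated_card_le A) auto
  from T show ?thesis
    by (elim conjE) (intro exI[of _ N] exI[of _ T] conjI N'(1,2) packed net; assumption)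
qed

text \<open>The net of the previous lemma, with each point of the rim joined to it.\<close>

lemma skeleton:
  assumes A: "finite A" "A \<noteq> {}" "A \<subseteq> V" "connected_graph A E"
  shows "\<exists>(N :: 'a set) T. finite T \<and> T \<noteq> {} \<and> T \<subseteq> V \<and> connected_graph T E \<and> rim A \<subseteq> T \<and>
    card T \<le> (2 * r + 1) * card N + 2 * r * card (rim A) \<and>
    card N * card (wball r) \<le> card A + card (wball r) * card (rim A) \<and>
    (\<forall>a\<in>A. \<exists>x\<in>T. \<exists>g\<in>wball (2 * r). a = g \<otimes> x)"
proof -
  from spanning_net[OF A, of r] obtain N T where NT: "N \<subseteq> A" "finite T" "T \<subseteq> V" "connected_graph T E" "N \<subseteq> T" "N \<noteq> {}"
    "card T \<le> (2 * r + 1) * card N" "card N * card (wball r) \<le> card A + card (wball r) * card (rim A)"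
    and net: "\<forall>a\<in>A. \<exists>x\<in>N. \<exists>g\<in>wball (2 * r). a = g \<otimes> x"
    by (elim exE conjE) (rule that, assumption+)
  have "\<exists>T'. finite T' \<and> T' \<subseteq> V \<and> connected_graph T' E \<and> T \<subseteq> T' \<and> B \<subseteq> T' \<and>
      card T' \<le> card T + 2 * r * card B" if "finite B" "B \<subseteq> A" for B
    using that
  proof (induction rule: finite_induct)
    case empty
    then show ?case using NT by (intro exI[of _ T]) auto
  next
    case (insert b B)
    then obtain T' where T': "finite T'" "T' \<subseteq> V" "connected_graph T' E" "T \<subseteq> T'" "B \<subseteq> T'"
      "card T' \<le> card T + 2 * r * card B" by auto
    obtain x g where x: "x \<in> N" "g \<in> wball (2 * r)" "b = g \<otimes> x" using net insert.prems by blast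
    then have "x \<in> T'" using T' NT by blast
    from attach_path[OF T'(1-3) this x(2)] obtain T'' where T'': "finite T''" "T'' \<subseteq> V" "connected_graph T'' E"
      "T' \<subseteq> T''" "b \<in> T''" "card T'' \<le> card T' + 2 * r" unfolding x(3) by blast
    then show ?case using T' insert.hyps by (intro exI[of _ T'']) auto
  qed
  from this[OF _ rim_subset] A(1) obtain T' where T': "finite T'" "T' \<subseteq> V" "connected_graph T' E" "T \<subseteq> T'"
    "rim A \<subseteq> T'" "card T' \<le> card T + 2 * r * card (rim A)" by auto
  have "\<forall>a\<in>A. \<exists>x\<in>T'. \<exists>g\<in>wball (2 * r). a = g \<otimes> x" using net NT(5) T'(4) by blast
  moreover have "card T' \<le> (2 * r + 1) * card N + 2 * r * card (rim A)" using T' NT by linarith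
  moreover have "T' \<noteq> {}" using NT T' by blast
  ultimately show ?thesis using T' NT(8) by (intro exI[of _ N] exI[of _ T']) simp
qed

section \<open>Large sets whose rim lies in a small connected set\<close>

text \<open>The number \<open>\<rho>\<close> bounds the radius of the tile; it must be small compared to \<open>|A|\<close> as well, because
consecutive translates will be joined by paths of length at most \<open>2 * \<rho> + 1\<close>. It is small since
every point of \<open>A\<close> is within \<open>2 * r\<close> of the connected set \<open>T\<close>, whose diameter is at most \<open>|T|\<close>.\<close>

lemma tile_exists:
  assumes "amenable_group G" "one_ended_group G" and inf: "infinite V" and \<delta>: "(\<delta>::real) > 0"
  shows "\<exists>A T \<rho>. finite A \<and> A \<noteq> {} \<and> A \<subseteq> V \<and> finite T \<and> T \<subseteq> V \<and> connected_graph T E \<and> \<one> \<in> T \<and>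
    rim A \<subseteq> T \<and> A \<subseteq> wball \<rho> \<and> real (card T + 2 * \<rho> + 1) \<le> \<delta> * card A"
proof -
  \<comment> \<open>Write a, N and b for the size of A, the net and the volume of a ball. With these choices of M and
    \<epsilon>, each of (2 r + 1) |N| / 2, (2 r + 1) |rim A| and 2 r + 1 is at most \<delta> a / 12. As
    |T| \<le> (2 r + 1) (|N| + |rim A|), this is enough for |T| + 2 \<rho> + 1 = 3 |T| + 4 r + 1.\<close>
  define M where "M = nat \<lceil>12 / \<delta>\<rceil>"
  have M: "12 / \<delta> \<le> real M" unfolding M_def by linarith
  obtain r where r: "M * (2 * r + 1) \<le> card (wball r)" using one_ended_group_growth[OF assms(2) inf] by blast
  define b where "b = card (wball r)"
  have "b > 0" unfolding b_def using one_in_wball finite_wball card_gt_0_iff by blast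
  have rb: "12 * real (2 * r + 1) \<le> \<delta> * b"
  proof -
    have "12 * real (2 * r + 1) = \<delta> * ((12 / \<delta>) * real (2 * r + 1))" using \<delta> by simp
    also have "\<dots> \<le> \<delta> * (real M * real (2 * r + 1))" using M \<delta> by (intro mult_right_mono mult_left_mono) auto
    also have "\<dots> = \<delta> * real (M * (2 * r + 1))" by (simp only: of_nat_mult)
    also have "\<dots> \<le> \<delta> * b" unfolding b_def using r \<delta> by (intro mult_left_mono) linarith+
    finally show ?thesis .
  qed
  \<comment> \<open>The first bound makes the thickened rim no larger than A itself, so that |N| b \<le> 2 a.\<close>
  define \<epsilon> where "\<epsilon> = min (1 / b) (\<delta> / (12 * (2 * r + 1)))"
  have "\<epsilon> > 0" using \<open>b > 0\<close> \<delta> by (simp add: \<epsilon>_def)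
  then obtain A where A: "finite A" "A \<noteq> {}" "A \<subseteq> V" "connected_graph A E" "real (card (rim A)) \<le> \<epsilon> * card A"
    using amenable_connected_small_rim[OF assms(1)] by blast
  from skeleton[OF A(1-4), of r, folded b_def] obtain N :: "'a set" and T where T: "finite T" "T \<noteq> {}" "T \<subseteq> V" "connected_graph T E" "rim A \<subseteq> T"
    "card T \<le> (2 * r + 1) * card N + 2 * r * card (rim A)"
    "card N * b \<le> card A + b * card (rim A)"
    and near: "\<forall>a\<in>A. \<exists>x\<in>T. \<exists>g\<in>wball (2 * r). a = g \<otimes> x"
    by (elim exE conjE) (rule that, assumption+)
  define a where "a = real (card A)"
  have "card (rim A) \<ge> 1" using rim_nonempty[OF inf A(1,3,2)] A(1) by (simp add: Suc_le_eq card_gt_0_iff)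
  have rim1: "real b * card (rim A) \<le> a"
  proof -
    have "real b * card (rim A) \<le> real b * ((1 / b) * a)"
      using A(5) mult_right_mono[of \<epsilon> "1 / b" a] unfolding a_def
      by (intro mult_left_mono) (auto simp: \<epsilon>_def)
    then show ?thesis using \<open>b > 0\<close> by simp
  qed
  have rim2: "12 * real (2 * r + 1) * card (rim A) \<le> \<delta> * a"
  proof -
    have "real (card (rim A)) \<le> \<delta> / (12 * (2 * r + 1)) * a"
      using A(5) mult_right_mono[of \<epsilon> "\<delta> / (12 * (2 * r + 1))" a] unfolding a_def
      by (auto simp: \<epsilon>_def)
    then show ?thesis by (simp add: field_simps)
  qed
  have rim3: "12 * real (2 * r + 1) \<le> \<delta> * a"
  proof -
    have "12 * real (2 * r + 1) * 1 \<le> 12 * real (2 * r + 1) * card (rim A)"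
      using \<open>card (rim A) \<ge> 1\<close> by (intro mult_left_mono) auto
    then show ?thesis using rim2 by linarith
  qed
  have N: "12 * real (2 * r + 1) * card N \<le> 2 * \<delta> * a"
  proof -
    have "real (card N * b) \<le> real (card A + b * card (rim A))" using T(7) of_nat_le_iff by blast
    then have "real b * card N \<le> 2 * a" using rim1 by (simp add: a_def mult.commute)
    then have "\<delta> * (real b * card N) \<le> \<delta> * (2 * a)" using \<delta> by (intro mult_left_mono) auto
    moreover have "12 * real (2 * r + 1) * card N \<le> (\<delta> * b) * card N" using rb by (intro mult_right_mono) auto
    ultimately show ?thesis by (simp add: algebra_simps)
  qed
  have "real (card T) \<le> real ((2 * r + 1) * card N + 2 * r * card (rim A))" using T(6) of_nat_le_iff by blast
  also have "\<dots> \<le> real (2 * r + 1) * card N + real (2 * r + 1) * card (rim A)"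
    by (simp add: algebra_simps)
  finally have T12: "12 * real (card T) \<le> 3 * \<delta> * a" using N rim2 by linarith
  obtain t where t: "t \<in> T" using T by blast
  then have tV: "t \<in> V" "inv t \<in> V" using T by auto
  define A' where "A' = translate A (inv t)"
  define T' where "T' = translate T (inv t)"
  define \<rho> where "\<rho> = 2 * r + card T"
  have T': "finite T'" "T' \<subseteq> V" "connected_graph T' E" "card T' = card T"
    unfolding T'_def using T tV connected_translate card_translate by auto
  have one: "\<one> \<in> T'" unfolding T'_def using t tV by (force intro: image_eqI[of _ _ t])
  have "rim A' \<subseteq> T'" unfolding A'_def T'_def using rim_translate[OF tV(2) A(3)] T(5) by blast
  moreover have "A' \<subseteq> wball \<rho>"
  proof
    fix y assume "y \<in> A'"
    then obtain a where a: "a \<in> A" "y = a \<otimes> inv t" unfolding A'_def by blast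
    then obtain x g where x: "x \<in> T" "g \<in> wball (2 * r)" "a = g \<otimes> x" using near by blast
    then have "y = g \<otimes> (x \<otimes> inv t)" using a tV T wball_closed by (simp add: m_assoc subset_iff)
    moreover have "x \<otimes> inv t \<in> wball (card T)"
      using connected_diameter[OF T'(1-3) one] x(1) T'(4) unfolding T'_def by auto
    ultimately show "y \<in> wball \<rho>" unfolding \<rho>_def using wball_mult x(2) by simp
  qed
  moreover have "card A' = card A" unfolding A'_def using card_translate tV A by blast
  moreover have "real (card T + 2 * \<rho> + 1) \<le> \<delta> * card A"
    using T12 rim3 unfolding \<rho>_def a_def by simp
  moreover have "finite A'" "A' \<noteq> {}" "A' \<subseteq> V" unfolding A'_def using A tV by auto
  ultimately show ?thesis using T' one
    by (intro exI[of _ A'] exI[of _ T'] exI[of _ \<rho>]) simp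
qed

text \<open>The translates of \<open>A\<close> that meet \<open>W\<close> are those by elements of a finite set. An edge leaving that
set gives an element \<open>z\<close> whose translate is disjoint from \<open>W\<close> and an adjacent element \<open>y\<close> whose
translate meets some earlier tile, so \<open>z\<close> is within \<open>2 * \<rho> + 1\<close> of the centre of that tile.\<close>

lemma chain_of_tiles:
  assumes inf: "infinite V" and A: "finite A" "A \<noteq> {}" "A \<subseteq> V" "A \<subseteq> wball \<rho>"
    and T: "finite T" "T \<subseteq> V" "connected_graph T E" "\<one> \<in> T" "rim A \<subseteq> T"
  shows "\<exists>X W T'. finite X \<and> X \<noteq> {} \<and> X \<subseteq> T' \<and> W = (\<Union>x\<in>X. translate A x) \<and> card W = Suc j * card A \<and>
    finite T' \<and> T' \<subseteq> V \<and> connected_graph T' E \<and> rim W \<subseteq> T' \<and> card T' \<le> Suc j * (card T + 2 * \<rho> + 1)"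
proof (induction j)
  case 0
  have "(\<Union>x\<in>{\<one>}. translate A x) = A" using A(3) by force
  then show ?case using T by (intro exI[of _ "{\<one>}"] exI[of _ A] exI[of _ T]) auto
next
  case (Suc j)
  then obtain X W T' where X: "finite X" "X \<noteq> {}" "X \<subseteq> T'" and W: "W = (\<Union>x\<in>X. translate A x)" "card W = Suc j * card A"
    and T': "finite T'" "T' \<subseteq> V" "connected_graph T' E" "rim W \<subseteq> T'" "card T' \<le> Suc j * (card T + 2 * \<rho> + 1)"
    by blast
  have XV: "X \<subseteq> V" using X T' by blast
  have W': "finite W" "W \<subseteq> V" using W X A XV by auto
  \<comment> \<open>The elements whose tile would overlap the tiles that are already placed.\<close>
  let ?bad = "{y \<in> V. translate A y \<inter> W \<noteq> {}}"
  have "?bad \<subseteq> (\<lambda>(a, w). inv a \<otimes> w) ` (A \<times> W)"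
  proof
    fix y assume "y \<in> ?bad"
    then obtain a where a: "y \<in> V" "a \<in> A" "a \<otimes> y \<in> W" by blast
    then have "y = inv a \<otimes> (a \<otimes> y)" using A by auto
    then show "y \<in> (\<lambda>(a, w). inv a \<otimes> w) ` (A \<times> W)" using a by (auto intro!: image_eqI[of _ _ "(a, a \<otimes> y)"])
  qed
  then have "finite ?bad" by (rule finite_subset) (use A W' in auto)
  moreover have "?bad \<noteq> {}"
  proof -
    obtain x a where "x \<in> X" "a \<in> A" using X A by blast
    then have "x \<in> ?bad" using XV W by auto
    then show ?thesis by blast
  qed
  ultimately obtain y s where y: "y \<in> ?bad" "s \<in> S" "s \<otimes> y \<notin> ?bad"
    using exit_finite_set[OF inf, of ?bad] by blast
  define z where "z = s \<otimes> y"
  have zV: "z \<in> V" and disj: "translate A z \<inter> W = {}" using y by (auto simp: z_def)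
  obtain a x a' where x: "x \<in> X" "a \<in> A" "a' \<in> A" "a \<otimes> y = a' \<otimes> x" using y(1) W by auto
  have xV: "x \<in> V" and yV: "y \<in> V" "a \<in> V" "a' \<in> V" using x XV A y by auto
  have "y = inv a \<otimes> (a \<otimes> y)" using yV by simp
  also have "\<dots> = (inv a \<otimes> a') \<otimes> x" unfolding x(4) using yV xV by (simp add: m_assoc)
  finally have "z = (s \<otimes> (inv a \<otimes> a')) \<otimes> x" unfolding z_def using y(2) yV xV by (simp add: m_assoc)
  moreover have "inv a \<otimes> a' \<in> wball (\<rho> + \<rho>)" using x A by (intro wball_mult inv_wball) auto
  then have "s \<otimes> (inv a \<otimes> a') \<in> wball (2 * \<rho> + 1)" using S_mult_wball[OF y(2)] by (simp add: mult_2)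
  moreover have "x \<in> T'" using x X by blast
  ultimately obtain T1 where T1: "finite T1" "T1 \<subseteq> V" "connected_graph T1 E" "T' \<subseteq> T1" "z \<in> T1"
    "card T1 \<le> card T' + (2 * \<rho> + 1)"
    using attach_path[OF T'(1-3), of x "s \<otimes> (inv a \<otimes> a')" "2 * \<rho> + 1"] by blast
  define T2 where "T2 = T1 \<union> translate T z"
  have "z \<in> translate T z" using T(4) zV by (force intro: image_eqI[of _ _ \<one>])
  then have conn: "connected_graph T2 E"
    unfolding T2_def using connected_graph_Un[OF T1(3) connected_translate[OF zV T(2,3)] T1(5)] by blast
  have cT2: "card T2 \<le> card T1 + card T"
    unfolding T2_def using card_Un_le[of T1 "translate T z"] card_translate[OF zV T(2)] by simp
  define W2 where "W2 = W \<union> translate A z"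
  have cW2: "card W2 = Suc (Suc j) * card A"
    unfolding W2_def using disj W' A W(2) card_translate[OF zV A(3)]
    by (subst card_Un_disjoint) auto
  have "rim W2 \<subseteq> T2"
    unfolding W2_def T2_def using rim_Un[of W "translate A z"] T'(4) T1(4) rim_translate[OF zV A(3)] T(5) by blast
  moreover have "W2 = (\<Union>x\<in>insert z X. translate A x)" unfolding W2_def W(1) by auto
  moreover have "insert z X \<subseteq> T2" using X T1 unfolding T2_def by auto
  moreover have "card T2 \<le> Suc (Suc j) * (card T + 2 * \<rho> + 1)" using cT2 T1(6) T'(5) by simp
  moreover have "finite T2" "T2 \<subseteq> V" unfolding T2_def using T1 T zV by auto
  ultimately show ?case using X conn cW2
    by (intro exI[of _ "insert z X"] exI[of _ W2] exI[of _ T2]) simp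
qed

text \<open>Opening the edges in \<open>T\<close> and closing those that leave \<open>W \<union> T\<close> seals \<open>W\<close> off from the rest of the
graph while gluing its rim together.\<close>

definition sealed :: "'a set \<Rightarrow> 'a set \<Rightarrow> bool" where
  "sealed W T \<longleftrightarrow> finite W \<and> W \<subseteq> V \<and> finite T \<and> T \<subseteq> V \<and> connected_graph T E \<and> rim W \<subseteq> T"

text \<open>With \<open>m div card A + 1\<close> tiles the union has between \<open>m\<close> and \<open>2 * m\<close> elements once \<open>m\<close> exceeds the
size of a tile, so the cost per element of a tile carries over.\<close>

lemma cheap_sealed_sets:
  assumes "amenable_group G" "one_ended_group G" and inf: "infinite V" and \<epsilon>: "(\<epsilon>::real) > 0"
  shows "\<exists>M. \<forall>m\<ge>M. \<exists>W T. sealed W T \<and> m \<le> card W \<and> real (card T) \<le> \<epsilon> * m"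
proof -
  obtain A T \<rho> where A: "finite A" "A \<noteq> {}" "A \<subseteq> V" and T: "finite T" "T \<subseteq> V" "connected_graph T E" "\<one> \<in> T"
    "rim A \<subseteq> T" "A \<subseteq> wball \<rho>" and cost: "real (card T + 2 * \<rho> + 1) \<le> \<epsilon> / 2 * card A"
    using tile_exists[OF assms(1-3), of "\<epsilon> / 2"] \<epsilon> by auto
  have a: "card A > 0" using A by (simp add: card_gt_0_iff)
  have "\<exists>W T. sealed W T \<and> m \<le> card W \<and> real (card T) \<le> \<epsilon> * m" if m: "card A \<le> m" for m
  proof -
    define j where "j = m div card A"
    have jm: "j * card A \<le> m" "m \<le> Suc j * card A"
      unfolding j_def using div_times_less_eq_dividend dividend_less_times_div[OF a, of m] by (auto simp: mult.commute)
    obtain W T' where W: "finite T'" "T' \<subseteq> V" "connected_graph T' E" "rim W \<subseteq> T'" "finite W" "W \<subseteq> V"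
      "card W = Suc j * card A" "card T' \<le> Suc j * (card T + 2 * \<rho> + 1)"
    proof -
      obtain X W T' where 1: "finite X" "X \<subseteq> T'" "W = (\<Union>x\<in>X. translate A x)" "card W = Suc j * card A"
        "finite T'" "T' \<subseteq> V" "connected_graph T' E" "rim W \<subseteq> T'" "card T' \<le> Suc j * (card T + 2 * \<rho> + 1)"
        using chain_of_tiles[OF inf A T(6) T(1-5), of j] by blast
      moreover have "finite W" using 1 A by auto
      moreover have "W \<subseteq> V" using 1 A by (auto dest!: subsetD)
      ultimately show thesis using that by blast
    qed
    have "real (card T') \<le> real (Suc j * (card T + 2 * \<rho> + 1))" using W(8) of_nat_le_iff by blast
    also have "\<dots> = real (Suc j) * real (card T + 2 * \<rho> + 1)" by (simp only: of_nat_mult)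
    also have "\<dots> \<le> real (Suc j) * (\<epsilon> / 2 * card A)" using cost by (intro mult_left_mono) auto
    also have "\<dots> = \<epsilon> / 2 * real (j * card A + card A)" by (simp add: algebra_simps)
    also have "\<dots> \<le> \<epsilon> / 2 * real (2 * m)" using jm m \<epsilon> by (intro mult_left_mono of_nat_mono) auto
    finally have "real (card T') \<le> \<epsilon> * m" by simp
    then show ?thesis using W jm unfolding sealed_def by (intro exI[of _ W] exI[of _ T']) auto
  qed
  then show ?thesis by blast
qed

end

section \<open>Bernoulli percolation on a countable graph\<close>

lemma space_bond_percolation: "space (bond_percolation E p) = (\<Pi>\<^sub>E e\<in>E. UNIV)"
  by (simp add: bond_percolation_def space_PiM)

lemma sets_bond_percolation_cong: "sets (bond_percolation E p) = sets (bond_percolation E q)"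
  unfolding bond_percolation_def by (intro sets_PiM_cong) auto

lemma prob_space_bond_percolation: "prob_space (bond_percolation E p)"
  unfolding bond_percolation_def by (intro prob_space_PiM measure_pmf.prob_space_axioms)

lemma sets_edge_open: "e \<in> E \<Longrightarrow> {\<omega> \<in> space (bond_percolation E p). \<omega> e} \<in> sets (bond_percolation E p)"
proof -
  assume e: "e \<in> E"
  have "(\<lambda>\<omega>. \<omega> e) \<in> measurable (bond_percolation E p) (measure_pmf (bernoulli_pmf p))"
    unfolding bond_percolation_def using e by (rule measurable_component_singleton)
  from measurable_sets[OF this, of "{True}"] show ?thesis
    by (simp add: vimage_def Int_def conj_commute)
qed

lemma sets_connected:
  assumes "countable V"
  shows "{\<omega> \<in> space (bond_percolation E p). y \<in> open_cluster V E \<omega> x} \<in> sets (bond_percolation E p)"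
proof -
  let ?M = "bond_percolation E p"
  let ?R = "\<lambda>\<omega>. adj V {e \<in> E. \<omega> e}"
  have step: "{\<omega> \<in> space ?M. (z, y) \<in> ?R \<omega>} \<in> sets ?M" for z y
  proof (cases "z \<in> V \<and> y \<in> V \<and> {z, y} \<in> E")
    case True
    then show ?thesis using sets_edge_open[of "{z, y}" E p] by (simp add: adj_def)
  next
    case False
    then have "{\<omega> \<in> space ?M. (z, y) \<in> ?R \<omega>} = {}" by (auto simp: adj_def)
    then show ?thesis by (simp only: sets.empty_sets)
  qed
  have pow: "{\<omega> \<in> space ?M. (x, y) \<in> ?R \<omega> ^^ n} \<in> sets ?M" for n y
  proof (induction n arbitrary: y)
    case 0
    show ?case by (cases "x = y") auto
  next
    case (Suc n)
    have "{\<omega> \<in> space ?M. (x, y) \<in> ?R \<omega> ^^ Suc n} = {\<omega> \<in> space ?M. \<exists>z\<in>V. (x, z) \<in> ?R \<omega> ^^ n \<and> (z, y) \<in> ?R \<omega>}"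
      by (auto simp: adj_def)
    also have "\<dots> \<in> sets ?M"
      by (intro sets.sets_Collect_countable_Ex' sets.sets_Collect_conj Suc step assms)
    finally show ?case .
  qed
  have "{\<omega> \<in> space ?M. y \<in> open_cluster V E \<omega> x} = {\<omega> \<in> space ?M. \<exists>n. (x, y) \<in> ?R \<omega> ^^ n}"
    by (simp add: open_cluster_def component_of_def rtrancl_is_UN_relpow)
  also have "\<dots> \<in> sets ?M" by (intro sets.sets_Collect_countable_Ex pow)
  finally show ?thesis .
qed

lemma open_cluster_subset: "x \<in> V \<Longrightarrow> open_cluster V E \<omega> x \<subseteq> V"
  unfolding open_cluster_def component_of_def using adj_rtrancl_closed by fastforce

text \<open>The cluster takes each value in the countable collection of finite vertex sets on a measurable set.\<close>

lemma sets_cluster_size_ge: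
  assumes "countable V" "x \<in> V"
  shows "{\<omega> \<in> space (bond_percolation E p). finite (open_cluster V E \<omega> x) \<and> n \<le> card (open_cluster V E \<omega> x)}
    \<in> sets (bond_percolation E p)"
proof -
  let ?M = "bond_percolation E p" and ?C = "\<lambda>\<omega>. open_cluster V E \<omega> x"
  let ?\<F> = "{F. finite F \<and> F \<subseteq> V}"
  have eq: "?C \<omega> = F \<longleftrightarrow> (\<forall>y\<in>V. y \<in> ?C \<omega> \<longleftrightarrow> y \<in> F)" if "F \<subseteq> V" for \<omega> F
    using that open_cluster_subset[OF assms(2), of E \<omega>] by blast
  have "{\<omega> \<in> space ?M. \<forall>y\<in>V. y \<in> ?C \<omega> \<longleftrightarrow> y \<in> F} \<in> sets ?M" for F
  proof (intro sets.sets_Collect_countable_All' assms(1))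
    show "{\<omega> \<in> space ?M. y \<in> ?C \<omega> \<longleftrightarrow> y \<in> F} \<in> sets ?M" for y
      using sets_connected[OF assms(1), of E p y x] sets.sets_Collect_neg[OF sets_connected[OF assms(1), of E p y x]]
      by (cases "y \<in> F") auto
  qed
  then have "{\<omega> \<in> space ?M. ?C \<omega> = F} \<in> sets ?M" if "F \<subseteq> V" for F
    using eq[OF that] by simp
  then have "{\<omega> \<in> space ?M. \<exists>F\<in>{F. finite F \<and> F \<subseteq> V \<and> n \<le> card F}. ?C \<omega> = F} \<in> sets ?M"
    by (intro sets.sets_Collect_countable_Ex' countable_subset[OF _ countable_Collect_finite_subset[OF assms(1)]]) auto
  also have "{\<omega> \<in> space ?M. \<exists>F\<in>{F. finite F \<and> F \<subseteq> V \<and> n \<le> card F}. ?C \<omega> = F} =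
      {\<omega> \<in> space ?M. finite (?C \<omega>) \<and> n \<le> card (?C \<omega>)}"
    using open_cluster_subset[OF assms(2), of E] by auto
  finally show ?thesis .
qed

lemma sets_cluster_infinite:
  assumes "countable V" "x \<in> V"
  shows "{\<omega> \<in> space (bond_percolation E p). infinite (open_cluster V E \<omega> x)} \<in> sets (bond_percolation E p)"
  using sets.sets_Collect_neg[OF sets_cluster_size_ge[OF assms, of E p 0]] by simp

text \<open>The parentheses in \<open>(\<omega>)(e := b)\<close> prevent \<open>\<omega>(\<close> from being read as a Landau symbol.\<close>

lemma measurable_fun_upd:
  assumes "e \<in> E"
  shows "(\<lambda>\<omega>. (\<omega>)(e := b)) \<in> measurable (bond_percolation E p) (bond_percolation E p)"
proof -
  have "(\<lambda>(\<omega>, x). (\<omega>)(e := x)) \<in> measurable (Pi\<^sub>M E (\<lambda>_. measure_pmf (bernoulli_pmf p)) \<Otimes>\<^sub>M measure_pmf (bernoulli_pmf p))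
      (Pi\<^sub>M (insert e E) (\<lambda>_. measure_pmf (bernoulli_pmf p)))"
    by (rule measurable_add_dim)
  then have "(\<lambda>(\<omega>, x). (\<omega>)(e := x)) \<in> measurable (bond_percolation E p \<Otimes>\<^sub>M measure_pmf (bernoulli_pmf p)) (bond_percolation E p)"
    unfolding bond_percolation_def using assms by (simp add: insert_absorb)
  moreover have "(\<lambda>\<omega>. (\<omega>, b)) \<in> measurable (bond_percolation E p) (bond_percolation E p \<Otimes>\<^sub>M measure_pmf (bernoulli_pmf p))"
    by (intro measurable_Pair measurable_ident measurable_const) auto
  ultimately have "(\<lambda>\<omega>. case (\<omega>, b) of (\<omega>, x) \<Rightarrow> (\<omega>)(e := x)) \<in> measurable (bond_percolation E p) (bond_percolation E p)"
    by (rule measurable_compose[rotated])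
  then show ?thesis by simp
qed

text \<open>The law of the configuration does not change if the state of \<open>e\<close> is resampled. With probability
\<open>pmf (bernoulli_pmf p) b\<close>, independently of the other edges, the resampled state is \<open>b\<close>.\<close>

lemma finite_energy_edge:
  assumes e: "e \<in> E" and A: "A \<in> sets (bond_percolation E p)"
  shows "pmf (bernoulli_pmf p) b * measure (bond_percolation E p) {\<omega> \<in> space (bond_percolation E p). (\<omega>)(e := b) \<in> A}
    \<le> measure (bond_percolation E p) A"
proof -
  let ?B = "measure_pmf (bernoulli_pmf p)"
  let ?M = "bond_percolation E p" and ?M' = "bond_percolation (E - {e}) p"
  interpret M: prob_space ?M by (rule prob_space_bond_percolation)
  interpret M': prob_space ?M' by (rule prob_space_bond_percolation)
  interpret B: prob_space ?B by (rule measure_pmf.prob_space_axioms)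
  interpret BM: pair_prob_space ?B ?M' ..
  have times: "measure (?B \<Otimes>\<^sub>M ?M') (C \<times> N) = measure ?B C * measure ?M' N" if "N \<in> sets ?M'" for C N
    using that by (simp add: measure_def M'.emeasure_pair_measure_Times enn2real_mult)
  let ?g = "\<lambda>(x, X). X(e := x)"
  have distr: "distr (?B \<Otimes>\<^sub>M ?M') ?M ?g = ?M"
    using distr_pair_PiM_eq_PiM[of "E - {e}" "\<lambda>_. ?B" e] e
    by (simp add: bond_percolation_def insert_absorb measure_pmf.prob_space_axioms)
  have g: "?g \<in> measurable (?B \<Otimes>\<^sub>M ?M') ?M"
  proof -
    have "(\<lambda>(\<omega>, x). (\<omega>)(e := x)) \<in> measurable (?M' \<Otimes>\<^sub>M ?B) (Pi\<^sub>M (insert e (E - {e})) (\<lambda>_. ?B))"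
      unfolding bond_percolation_def by (rule measurable_add_dim)
    then have "(\<lambda>(\<omega>, x). (\<omega>)(e := x)) \<in> measurable (?M' \<Otimes>\<^sub>M ?B) ?M"
      using e by (simp add: bond_percolation_def insert_absorb)
    from measurable_compose[OF measurable_pair_swap' this] show ?thesis
      by (simp add: case_prod_beta')
  qed
  \<comment> \<open>Configurations of the other edges for which the event occurs as soon as the edge has state b.\<close>
  define N where "N = {X \<in> space ?M'. X(e := b) \<in> A}"
  have fst_snd: "space (?B \<Otimes>\<^sub>M ?M') = UNIV \<times> space ?M'" by (simp add: space_pair_measure)
  have upd_space: "X(e := x) \<in> space ?M" if "X \<in> space ?M'" for X x
    using that e by (auto simp: space_bond_percolation PiE_iff extensional_def)
  have "(\<lambda>X. (b, X)) \<in> measurable ?M' (?B \<Otimes>\<^sub>M ?M')" by (intro measurable_Pair1') simp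
  from measurable_compose[OF this g] have "(\<lambda>X. X(e := b)) \<in> measurable ?M' ?M" by simp
  from measurable_sets[OF this A] have N: "N \<in> sets ?M'"
    unfolding N_def by (simp add: vimage_def Int_def conj_commute)
  have "measure ?M {\<omega> \<in> space ?M. (\<omega>)(e := b) \<in> A} = measure (?B \<Otimes>\<^sub>M ?M') (?g -` {\<omega> \<in> space ?M. (\<omega>)(e := b) \<in> A} \<inter> space (?B \<Otimes>\<^sub>M ?M'))"
  proof -
    have "{\<omega> \<in> space ?M. (\<omega>)(e := b) \<in> A} \<in> sets ?M"
      using measurable_sets[OF measurable_fun_upd[OF e] A] by (simp add: vimage_def Int_def conj_commute)
    from measure_distr[OF g this] show ?thesis unfolding distr .
  qed
  also have "?g -` {\<omega> \<in> space ?M. (\<omega>)(e := b) \<in> A} \<inter> space (?B \<Otimes>\<^sub>M ?M') = UNIV \<times> N"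
    unfolding fst_snd N_def using upd_space by auto
  also have "measure (?B \<Otimes>\<^sub>M ?M') (UNIV \<times> N) = measure ?M' N"
    using times[OF N, of UNIV] by simp
  finally have 1: "measure ?M {\<omega> \<in> space ?M. (\<omega>)(e := b) \<in> A} = measure ?M' N" .
  have "measure ?M A = measure (?B \<Otimes>\<^sub>M ?M') (?g -` A \<inter> space (?B \<Otimes>\<^sub>M ?M'))"
    using measure_distr[OF g A] unfolding distr .
  moreover have "measure (?B \<Otimes>\<^sub>M ?M') ({b} \<times> N) \<le> measure (?B \<Otimes>\<^sub>M ?M') (?g -` A \<inter> space (?B \<Otimes>\<^sub>M ?M'))"
    by (intro BM.P.finite_measure_mono measurable_sets[OF g A]) (auto simp: N_def fst_snd)
  moreover have "measure (?B \<Otimes>\<^sub>M ?M') ({b} \<times> N) = measure ?B {b} * measure ?M' N"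
    by (rule times[OF N])
  ultimately show ?thesis unfolding 1 by (simp add: measure_pmf_single)
qed

text \<open>Both states have probability at least \<open>p * (1 - p)\<close>, which avoids counting open and closed edges separately.\<close>

lemma finite_energy:
  fixes p :: real
  assumes "finite F" "F \<subseteq> E" "0 \<le> p" "p \<le> 1" "A \<in> sets (bond_percolation E p)"
  shows "{\<omega> \<in> space (bond_percolation E p). override_on \<omega> \<tau> F \<in> A} \<in> sets (bond_percolation E p) \<and>
    (p * (1 - p)) ^ card F * measure (bond_percolation E p) {\<omega> \<in> space (bond_percolation E p). override_on \<omega> \<tau> F \<in> A}
    \<le> measure (bond_percolation E p) A"
  using assms(1,2,5)
proof (induction F arbitrary: A rule: finite_induct)
  case empty
  then have "{\<omega> \<in> space (bond_percolation E p). \<omega> \<in> A} = A" using sets.sets_into_space by blast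
  then show ?case using empty by simp
next
  case (insert e F)
  let ?M = "bond_percolation E p"
  have e: "e \<in> E" "F \<subseteq> E" using insert.prems by auto
  let ?A = "{\<omega> \<in> space ?M. (\<omega>)(e := \<tau> e) \<in> A}"
  have A: "?A \<in> sets ?M"
    using measurable_sets[OF measurable_fun_upd[OF e(1)] insert.prems(2)] by (simp add: vimage_def Int_def conj_commute)
  have "override_on \<omega> \<tau> F \<in> space ?M" if "\<omega> \<in> space ?M" for \<omega>
    using that e(2) by (auto simp: space_bond_percolation PiE_iff extensional_def override_on_def)
  then have eq: "{\<omega> \<in> space ?M. override_on \<omega> \<tau> (insert e F) \<in> A} = {\<omega> \<in> space ?M. override_on \<omega> \<tau> F \<in> ?A}"
    by (auto simp: override_on_insert)
  note IH = insert.IH[OF e(2) A]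
  have pq: "p * (1 - p) \<le> pmf (bernoulli_pmf p) (\<tau> e)"
    using assms(3,4) by (cases "\<tau> e") (auto intro: mult_left_le mult_left_le_one_le)
  have "(p * (1 - p)) ^ card (insert e F) * measure ?M {\<omega> \<in> space ?M. override_on \<omega> \<tau> F \<in> ?A}
      = (p * (1 - p)) * ((p * (1 - p)) ^ card F * measure ?M {\<omega> \<in> space ?M. override_on \<omega> \<tau> F \<in> ?A})"
    using insert.hyps by simp
  also have "\<dots> \<le> (p * (1 - p)) * measure ?M ?A"
    using IH assms(3,4) by (intro mult_left_mono) auto
  also have "\<dots> \<le> pmf (bernoulli_pmf p) (\<tau> e) * measure ?M ?A" using pq by (intro mult_right_mono) auto
  also have "\<dots> \<le> measure ?M A" by (rule finite_energy_edge[OF e(1) insert.prems(2)])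
  finally show ?case using IH unfolding eq by blast
qed

lemma distr_PiM_map_pmf:
  fixes K :: "'b pmf" and f :: "'b \<Rightarrow> 'c"
  shows "distr (\<Pi>\<^sub>M i\<in>I. measure_pmf K) (\<Pi>\<^sub>M i\<in>I. measure_pmf (map_pmf f K)) (\<lambda>\<omega>. \<lambda>i\<in>I. f (\<omega> i))
    = (\<Pi>\<^sub>M i\<in>I. measure_pmf (map_pmf f K))"
    (is "distr ?K ?I ?t = ?I")
proof (rule measure_eqI_PiM_infinite[symmetric, OF refl])
  interpret prob_space ?I by (intro prob_space_PiM measure_pmf.prob_space_axioms)
  show "finite_measure ?I" by unfold_locales
  fix A J assume J: "finite J" "J \<subseteq> I" and A: "\<And>i. i \<in> J \<Longrightarrow> A i \<in> sets (measure_pmf (map_pmf f K))"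
  have t: "?t \<in> measurable ?K ?I"
    by (intro measurable_restrict measurable_compose[OF measurable_component_singleton]) auto
  have "?I (prod_emb I (\<lambda>_. measure_pmf (map_pmf f K)) J (Pi\<^sub>E J A)) = (\<Prod>j\<in>J. measure_pmf (map_pmf f K) (A j))"
    using J A by (intro emeasure_PiM_emb measure_pmf.prob_space_axioms) auto
  also have "\<dots> = (\<Prod>j\<in>J. measure_pmf K (f -` A j))"
    by simp
  also have "\<dots> = ?K (prod_emb I (\<lambda>_. measure_pmf K) J (\<Pi>\<^sub>E j\<in>J. f -` A j))"
    using J by (intro emeasure_PiM_emb[symmetric] measure_pmf.prob_space_axioms) auto
  also have "prod_emb I (\<lambda>_. measure_pmf K) J (\<Pi>\<^sub>E j\<in>J. f -` A j) =
      ?t -` prod_emb I (\<lambda>_. measure_pmf (map_pmf f K)) J (Pi\<^sub>E J A) \<inter> space ?K"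
    using J by (auto simp: prod_emb_def space_PiM PiE_iff subset_iff)
  also have "?K \<dots> = distr ?K ?I ?t (prod_emb I (\<lambda>_. measure_pmf (map_pmf f K)) J (Pi\<^sub>E J A))"
    using J A by (intro emeasure_distr[symmetric] t sets_PiM_I) auto
  finally show "?I (prod_emb I (\<lambda>_. measure_pmf (map_pmf f K)) J (Pi\<^sub>E J A)) =
      distr ?K ?I ?t (prod_emb I (\<lambda>_. measure_pmf (map_pmf f K)) J (Pi\<^sub>E J A))" .
qed simp

text \<open>If \<open>a\<close> has parameter \<open>p\<close> and \<open>b\<close> has parameter \<open>r\<close>, independently, then \<open>a \<or> b\<close> has parameter
\<open>p + (1 - p) * r\<close>; choose \<open>r\<close> such that this is \<open>q\<close>.\<close>

lemma bernoulli_coupling: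
  assumes "0 \<le> p" "p \<le> q" "q \<le> 1"
  shows "\<exists>K :: (bool \<times> bool) pmf. map_pmf fst K = bernoulli_pmf p \<and> map_pmf snd K = bernoulli_pmf q \<and>
    (\<forall>x\<in>set_pmf K. fst x \<longrightarrow> snd x)"
proof -
  \<comment> \<open>For p = 1 also q = 1, and every r would do.\<close>
  define r where "r = (if p = 1 then 0 else (q - p) / (1 - p))"
  have r: "0 \<le> r" "r \<le> 1" "p + (1 - p) * r = q" using assms by (auto simp: r_def field_simps)
  define K where "K = bind_pmf (bernoulli_pmf p) (\<lambda>a. map_pmf (\<lambda>b. (a, a \<or> b)) (bernoulli_pmf r))"
  have "map_pmf fst K = bernoulli_pmf p"
    unfolding K_def by (simp add: map_bind_pmf pmf.map_comp o_def map_pmf_const bind_return_pmf')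
  moreover have "map_pmf snd K = bernoulli_pmf q"
  proof (rule pmf_eqI)
    fix b
    have *: "map_pmf snd K = bind_pmf (bernoulli_pmf p) (\<lambda>a. if a then return_pmf True else bernoulli_pmf r)"
      unfolding K_def by (auto simp: map_bind_pmf pmf.map_comp o_def map_pmf_const intro!: bind_pmf_cong)
    show "pmf (map_pmf snd K) b = pmf (bernoulli_pmf q) b"
      unfolding * using assms r by (cases b) (auto simp: pmf_bind algebra_simps)
  qed
  moreover have "\<forall>x\<in>set_pmf K. fst x \<longrightarrow> snd x" unfolding K_def by auto
  ultimately show ?thesis by blast
qed

text \<open>Couple the two percolations edge by edge such that every \<open>p\<close>-open edge is \<open>q\<close>-open.\<close>

lemma increasing_event_mono:
  assumes pq: "0 \<le> p" "p \<le> q" "q \<le> 1" and E: "countable E" and A: "A \<in> sets (bond_percolation E p)"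
    and up: "\<And>\<omega> \<omega>'. \<omega> \<in> A \<Longrightarrow> \<omega>' \<in> space (bond_percolation E p) \<Longrightarrow> (\<And>e. e \<in> E \<Longrightarrow> \<omega> e \<Longrightarrow> \<omega>' e) \<Longrightarrow> \<omega>' \<in> A"
  shows "measure (bond_percolation E p) A \<le> measure (bond_percolation E q) A"
proof -
  obtain K :: "(bool \<times> bool) pmf" where K: "map_pmf fst K = bernoulli_pmf p" "map_pmf snd K = bernoulli_pmf q"
    "\<And>x. x \<in> set_pmf K \<Longrightarrow> fst x \<Longrightarrow> snd x" using bernoulli_coupling[OF pq] by blast
  \<comment> \<open>Independent copies of the coupled pair, one for each edge.\<close>
  let ?N = "\<Pi>\<^sub>M i\<in>E. measure_pmf K"
  interpret N: prob_space ?N by (intro prob_space_PiM measure_pmf.prob_space_axioms)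
  let ?f = "\<lambda>\<omega>. \<lambda>i\<in>E. fst (\<omega> i)" and ?s = "\<lambda>\<omega>. \<lambda>i\<in>E. snd (\<omega> i)"
  have f: "?f \<in> measurable ?N (bond_percolation E p)" and s: "?s \<in> measurable ?N (bond_percolation E q)"
    unfolding bond_percolation_def
    by (intro measurable_restrict measurable_compose[OF measurable_component_singleton]; simp)+
  have A': "A \<in> sets (bond_percolation E q)" using A sets_bond_percolation_cong by blast
  have "measure (bond_percolation E p) A = measure ?N (?f -` A \<inter> space ?N)"
    using measure_distr[OF f A] distr_PiM_map_pmf[where K = K and f = fst and I = E] unfolding K bond_percolation_def by simp
  also have "\<dots> \<le> measure ?N (?s -` A \<inter> space ?N)"
  proof (rule N.finite_measure_mono_AE)
    have "AE x in ?N. fst (x e) \<longrightarrow> snd (x e)" if "e \<in> E" for e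
    proof (rule AE_PiM_component[OF _ that])
      show "AE x in measure_pmf K. fst x \<longrightarrow> snd x" using K(3) by (auto simp: AE_measure_pmf_iff)
    qed (rule measure_pmf.prob_space_axioms)
    then have "AE x in ?N. \<forall>e\<in>E. fst (x e) \<longrightarrow> snd (x e)" by (intro AE_ball_countable' E) 
    then show "AE x in ?N. x \<in> ?f -` A \<inter> space ?N \<longrightarrow> x \<in> ?s -` A \<inter> space ?N"
    proof (rule AE_mp, intro AE_I2 impI)
      fix x assume x: "\<forall>e\<in>E. fst (x e) \<longrightarrow> snd (x e)" "x \<in> ?f -` A \<inter> space ?N"
      have "?s x \<in> A"
        by (rule up[of "?f x"]) (use x in \<open>auto simp: space_bond_percolation\<close>)
      then show "x \<in> ?s -` A \<inter> space ?N" using x by auto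
    qed
    show "?s -` A \<inter> space ?N \<in> sets ?N" by (rule measurable_sets[OF s A'])
  qed
  also have "\<dots> = measure (bond_percolation E q) A"
    using measure_distr[OF s A'] distr_PiM_map_pmf[where K = K and f = snd and I = E] unfolding K bond_percolation_def by simp
  finally show ?thesis .
qed

text \<open>The left-hand side is the expected number of events that occur, minus \<open>n\<close>. The outcomes for which
fewer than \<open>n\<close> of the events occur contribute at most \<open>n\<close> to this expectation.\<close>

lemma expected_count_truncated:
  fixes n :: nat
  assumes "prob_space M" "finite W" and B: "\<And>x. x \<in> W \<Longrightarrow> B x \<in> sets M"
  shows "(\<Sum>x\<in>W. measure M (B x)) - n
    \<le> (\<Sum>x\<in>W. measure M {\<omega> \<in> B x. n \<le> card {y \<in> W. \<omega> \<in> B y}})"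
proof -
  interpret prob_space M by fact
  have count: "(\<Sum>y\<in>W. indicator (B y) \<omega>) = real (card {y \<in> W. \<omega> \<in> B y})" for \<omega>
    using assms(2) by (simp add: indicator_def sum.If_cases Int_def)
  have "(\<lambda>\<omega>. \<Sum>y\<in>W. indicator (B y) \<omega> :: real) \<in> borel_measurable M"
    using B by (intro borel_measurable_sum borel_measurable_indicator)
  then have "{\<omega> \<in> space M. real n \<le> (\<Sum>y\<in>W. indicator (B y) \<omega>)} \<in> sets M" by measurable
  then have L: "{\<omega> \<in> space M. n \<le> card {y \<in> W. \<omega> \<in> B y}} \<in> sets M" unfolding count by simp
  let ?L = "{\<omega> \<in> space M. n \<le> card {y \<in> W. \<omega> \<in> B y}}"
  have eq: "{\<omega> \<in> B x. n \<le> card {y \<in> W. \<omega> \<in> B y}} = B x \<inter> ?L" if "x \<in> W" for x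
    using sets.sets_into_space[OF B[OF that]] by blast
  have split: "prob (B x) = prob (B x \<inter> ?L) + prob (B x - ?L)" if "x \<in> W" for x
    using finite_measure_Diff'[OF B[OF that] L] by simp
  have "(\<Sum>x\<in>W. prob (B x - ?L)) = (\<Sum>x\<in>W. expectation (indicator (B x - ?L)))"
    using B L by (intro sum.cong refl) (simp add: sets.Diff)
  also have "\<dots> = expectation (\<lambda>\<omega>. \<Sum>x\<in>W. indicator (B x - ?L) \<omega>)"
    using B L by (intro Bochner_Integration.integral_sum[symmetric]) (auto simp: less_top[symmetric])
  also have "\<dots> \<le> expectation (\<lambda>\<omega>. real n)"
  proof (rule integral_mono)
    show "integrable M (\<lambda>\<omega>. \<Sum>x\<in>W. indicator (B x - ?L) \<omega> :: real)"
      using B L by (intro Bochner_Integration.integrable_sum) (auto simp: less_top[symmetric])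
    fix \<omega> assume \<omega>: "\<omega> \<in> space M"
    show "(\<Sum>x\<in>W. indicator (B x - ?L) \<omega>) \<le> real n"
    proof (cases "\<omega> \<in> ?L")
      case True
      then show ?thesis by simp
    next
      case False
      then have "(\<Sum>x\<in>W. indicator (B x - ?L) \<omega>) = (\<Sum>x\<in>W. indicator (B x) \<omega> :: real)"
        by (intro sum.cong refl) (auto simp: indicator_def)
      also have "\<dots> \<le> real n" unfolding count using False \<omega> by auto
      finally show ?thesis .
    qed
  qed simp
  also have "\<dots> = n" using prob_space by simp
  finally have "(\<Sum>x\<in>W. prob (B x - ?L)) \<le> n" .
  moreover have "(\<Sum>x\<in>W. prob (B x)) = (\<Sum>x\<in>W. prob (B x \<inter> ?L)) + (\<Sum>x\<in>W. prob (B x - ?L))"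
    unfolding sum.distrib[symmetric] by (intro sum.cong refl split)
  moreover have "(\<Sum>x\<in>W. prob {\<omega> \<in> B x. n \<le> card {y \<in> W. \<omega> \<in> B y}}) = (\<Sum>x\<in>W. prob (B x \<inter> ?L))"
    by (intro sum.cong refl arg_cong[of _ _ prob] eq)
  ultimately show ?thesis by simp
qed

section \<open>Infinite clusters on a Cayley graph\<close>

context marked_group begin

abbreviation "perc p \<equiv> bond_percolation E p"
abbreviation "cluster \<omega> x \<equiv> open_cluster V E \<omega> x"

lemma countable_E: "countable E"
proof (rule countable_subset)
  show "E \<subseteq> (\<lambda>(u, v). {u, v}) ` (V \<times> V)" by (auto simp: cayley_edges_def)
  show "countable ((\<lambda>(u, v). {u, v}) ` (V \<times> V))" using countable_V by simp
qed

lemma edge_carrier: "e \<in> E \<Longrightarrow> e \<subseteq> V"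
  by (auto simp: cayley_edges_def)

lemma translate_edge: "x \<in> V \<Longrightarrow> e \<in> E \<Longrightarrow> translate e x \<in> E"
proof -
  assume x: "x \<in> V" and e: "e \<in> E"
  then obtain u v s where "u \<in> V" "v \<in> V" "s \<in> S" "v = s \<otimes> u" "e = {u, v}"
    unfolding cayley_edges_def by blast
  moreover from this x have "v \<otimes> x = s \<otimes> (u \<otimes> x)" by (simp add: m_assoc)
  ultimately show ?thesis using x edge_iff[of "u \<otimes> x" "v \<otimes> x"] by auto
qed

lemma translate_edge_iff: "x \<in> V \<Longrightarrow> e \<subseteq> V \<Longrightarrow> translate e x \<in> E \<longleftrightarrow> e \<in> E"
proof
  assume x: "x \<in> V" "e \<subseteq> V" "translate e x \<in> E"
  then have "translate (translate e x) (inv x) \<in> E" by (intro translate_edge[OF inv_closed])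
  moreover have "translate (translate e x) (inv x) = e" using x by (force simp: image_image subset_iff)
  ultimately show "e \<in> E" by simp
qed (rule translate_edge)

lemma rtrancl_map: 
  assumes "(u, v) \<in> r\<^sup>*" "\<And>a b. (a, b) \<in> r \<Longrightarrow> (f a, f b) \<in> r'"
  shows "(f u, f v) \<in> r'\<^sup>*"
  using assms(1) by (induction rule: rtrancl_induct) (auto intro: rtrancl_into_rtrancl assms(2))

lemma cluster_translate:
  assumes x: "x \<in> V"
  shows "cluster \<omega> x = translate (cluster (\<lambda>e\<in>E. \<omega> (translate e x)) \<one>) x"
proof -
  let ?\<omega>' = "\<lambda>e\<in>E. \<omega> (translate e x)"
  have adj: "(u, v) \<in> adj V {e \<in> E. ?\<omega>' e} \<longleftrightarrow> (u \<otimes> x, v \<otimes> x) \<in> adj V {e \<in> E. \<omega> e}"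
    if "u \<in> V" "v \<in> V" for u v
    using translate_edge_iff[OF x, of "{u, v}"] that x by (auto simp: adj_def)
  have adj': "(u \<otimes> inv x, v \<otimes> inv x) \<in> adj V {e \<in> E. ?\<omega>' e}" if "(u, v) \<in> adj V {e \<in> E. \<omega> e}" for u v
  proof -
    have "u \<in> V" "v \<in> V" using that by (auto simp: adj_def)
    then show ?thesis using adj[of "u \<otimes> inv x" "v \<otimes> inv x"] that x by simp
  qed
  have adj'': "(u \<otimes> x, v \<otimes> x) \<in> adj V {e \<in> E. \<omega> e}" if "(u, v) \<in> adj V {e \<in> E. ?\<omega>' e}" for u v
  proof -
    have "u \<in> V" "v \<in> V" using that by (auto simp: adj_def)
    then show ?thesis using adj[of u v] that by simp
  qed
  show ?thesis
  proof (intro equalityI subsetI)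
    fix y assume y: "y \<in> cluster \<omega> x"
    then have yV: "y \<in> V" using open_cluster_subset[OF x] by blast
    have "(x \<otimes> inv x, y \<otimes> inv x) \<in> (adj V {e \<in> E. ?\<omega>' e})\<^sup>*"
      by (rule rtrancl_map[where f = "\<lambda>z. z \<otimes> inv x", OF _ adj'])
        (use y in \<open>simp_all add: open_cluster_def component_of_def\<close>)
    then have "y \<otimes> inv x \<in> cluster ?\<omega>' \<one>" using x by (simp add: open_cluster_def component_of_def)
    then show "y \<in> translate (cluster ?\<omega>' \<one>) x" using x yV by (auto intro!: image_eqI[of _ _ "y \<otimes> inv x"])
  next
    fix y assume "y \<in> translate (cluster ?\<omega>' \<one>) x"
    then obtain z where z: "z \<in> cluster ?\<omega>' \<one>" "y = z \<otimes> x" by blast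
    have "(\<one> \<otimes> x, z \<otimes> x) \<in> (adj V {e \<in> E. \<omega> e})\<^sup>*"
      by (rule rtrancl_map[where f = "\<lambda>z. z \<otimes> x", OF _ adj''])
        (use z in \<open>simp_all add: open_cluster_def component_of_def\<close>)
    then show "y \<in> cluster \<omega> x" using x z by (simp add: open_cluster_def component_of_def)
  qed
qed

text \<open>The predicate \<open>Q\<close> covers the events that are needed, \<open>|C| = \<infinity>\<close> and \<open>n \<le> |C| < \<infinity>\<close>, in one
statement; both depend on the cluster only through its size.\<close>

lemma perc_translation_invariant:
  assumes x: "x \<in> V" and Q: "\<And>y. y \<in> V \<Longrightarrow> {\<omega> \<in> space (perc p). Q (finite (cluster \<omega> y)) (card (cluster \<omega> y))} \<in> sets (perc p)"
  shows "measure (perc p) {\<omega> \<in> space (perc p). Q (finite (cluster \<omega> x)) (card (cluster \<omega> x))}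
    = measure (perc p) {\<omega> \<in> space (perc p). Q (finite (cluster \<omega> \<one>)) (card (cluster \<omega> \<one>))}"
proof -
  let ?t = "\<lambda>\<omega>. \<lambda>e\<in>E. \<omega> (translate e x)"
  let ?B = "measure_pmf (bernoulli_pmf p)"
  have inj: "inj_on (\<lambda>e. translate e x) E"
  proof (rule inj_onI)
    fix e f assume "e \<in> E" "f \<in> E" "translate e x = translate f x"
    then show "e = f" using inj_on_image_eq_iff[OF inj_translate[OF x subset_refl]] edge_carrier by blast
  qed
  have distr: "distr (perc p) (perc p) ?t = perc p"
    unfolding bond_percolation_def using inj translate_edge[OF x]
    by (intro distr_PiM_reindex[where M = "\<lambda>_. ?B"] measure_pmf.prob_space_axioms) auto
  have t: "?t \<in> measurable (perc p) (perc p)"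
    unfolding bond_percolation_def using translate_edge[OF x]
    by (intro measurable_restrict measurable_component_singleton) auto
  let ?A = "{\<omega> \<in> space (perc p). Q (finite (cluster \<omega> \<one>)) (card (cluster \<omega> \<one>))}"
  have size: "finite (cluster \<omega> x) = finite (cluster (?t \<omega>) \<one>) \<and> card (cluster \<omega> x) = card (cluster (?t \<omega>) \<one>)" for \<omega>
  proof -
    have "cluster (?t \<omega>) \<one> \<subseteq> V" by (rule open_cluster_subset) simp
    then show ?thesis unfolding cluster_translate[OF x]
      using inj_translate[OF x] card_translate[OF x] by (auto simp: finite_image_iff)
  qed
  have "measure (perc p) ?A = measure (perc p) (?t -` ?A \<inter> space (perc p))"
    using measure_distr[OF t Q[of \<one>]] unfolding distr by simp
  also have "?t -` ?A \<inter> space (perc p) = {\<omega> \<in> space (perc p). Q (finite (cluster \<omega> x)) (card (cluster \<omega> x))}"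
    using size measurable_space[OF t] by auto
  finally show ?thesis by simp
qed

definition theta :: "real \<Rightarrow> real" where
  "theta p = measure (perc p) {\<omega> \<in> space (perc p). infinite (cluster \<omega> \<one>)}"

lemma theta_eq: "x \<in> V \<Longrightarrow> measure (perc p) {\<omega> \<in> space (perc p). infinite (cluster \<omega> x)} = theta p"
  unfolding theta_def
  using perc_translation_invariant[of x p "\<lambda>f _. \<not> f"] sets_cluster_infinite[OF countable_V] by simp

text \<open>The set in the definition of the critical probability contains \<open>1\<close>, so its infimum is not a default
value.\<close>

lemma supercritical_nonempty:
  assumes "infinite V"
  shows "measure (perc 1) {\<omega> \<in> space (perc 1). \<exists>x\<in>V. infinite (cluster \<omega> x)} = 1"
proof -
  interpret prob_space "perc 1" by (rule prob_space_bond_percolation)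
  have "AE \<omega> in perc 1. \<omega> e" if "e \<in> E" for e
    unfolding bond_percolation_def
  proof (rule AE_PiM_component[OF measure_pmf.prob_space_axioms that])
    have "b" if "b \<in> set_pmf (bernoulli_pmf 1)" for b using that by (cases b) (auto simp: set_pmf_iff)
    then show "AE b in measure_pmf (bernoulli_pmf 1). b" unfolding AE_measure_pmf_iff by (intro ballI)
  qed
  then have "AE \<omega> in perc 1. \<forall>e\<in>E. \<omega> e" by (intro AE_ball_countable' countable_E)
  then have "AE \<omega> in perc 1. \<exists>x\<in>V. infinite (cluster \<omega> x)"
  proof (rule AE_mp, intro AE_I2 impI)
    fix \<omega> assume "\<forall>e\<in>E. \<omega> e"
    then have "{e \<in> E. \<omega> e} = E" by auto
    then have "V \<subseteq> cluster \<omega> \<one>"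
      using connected_V by (auto simp: open_cluster_def component_of_def connected_graph_def)
    then show "\<exists>x\<in>V. infinite (cluster \<omega> x)" using assms finite_subset by blast
  qed
  moreover have "{\<omega> \<in> space (perc 1). \<exists>x\<in>V. infinite (cluster \<omega> x)} \<in> sets (perc 1)"
    by (intro sets.sets_Collect_countable_Ex' sets_cluster_infinite countable_V)
  ultimately show ?thesis by (subst prob_Collect_eq_1)
qed

text \<open>Below \<open>p\<close> there is a parameter \<open>q\<close> with an infinite cluster somewhere almost surely. Then some
vertex, and by invariance the identity, is in an infinite cluster with positive probability at \<open>q\<close>;
by monotonicity this persists at \<open>p\<close>.\<close>

lemma theta_pos:
  assumes inf: "infinite V" and p: "critical_probability V E < p" "p < 1"
  shows "0 < p" "0 < theta p"
proof -
  let ?X = "{p \<in> {0..1::real}. measure (perc p) {\<omega> \<in> space (perc p). \<exists>x\<in>V. infinite (cluster \<omega> x)} = 1}"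
  have "1 \<in> ?X" using supercritical_nonempty[OF inf] by simp
  then have "?X \<noteq> {}" by blast
  then obtain q where q: "q \<in> ?X" "q < p"
    using p(1) cInf_lessD[of ?X p] unfolding critical_probability_def by blast
  then show "0 < p" by simp
  interpret prob_space "perc q" by (rule prob_space_bond_percolation)
  let ?I = "\<lambda>x. {\<omega> \<in> space (perc q). infinite (cluster \<omega> x)}"
  have I: "?I x \<in> sets (perc q)" if "x \<in> V" for x by (rule sets_cluster_infinite[OF countable_V that])
  have "theta q \<noteq> 0"
  proof
    assume "theta q = 0"
    then have "?I x \<in> null_sets (perc q)" if "x \<in> V" for x
      using theta_eq[OF that, of q] I[OF that] by (simp add: null_sets_def emeasure_eq_measure)
    then have "(\<Union>x\<in>V. ?I x) \<in> null_sets (perc q)" by (intro null_sets_UN' countable_V)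
    then have "measure (perc q) (\<Union>x\<in>V. ?I x) = 0" by (simp add: measure_eq_0_null_sets)
    moreover have "(\<Union>x\<in>V. ?I x) = {\<omega> \<in> space (perc q). \<exists>x\<in>V. infinite (cluster \<omega> x)}" by auto
    ultimately show False using q by simp
  qed
  then have "0 < theta q" by (simp add: theta_def order_less_le)
  also have "theta q \<le> measure (perc p) (?I \<one>)"
    unfolding theta_def
  proof (rule increasing_event_mono[OF _ _ _ countable_E I])
    fix \<omega> \<omega>' assume \<omega>: "\<omega> \<in> ?I \<one>" and \<omega>': "\<omega>' \<in> space (perc q)" "\<And>e. e \<in> E \<Longrightarrow> \<omega> e \<Longrightarrow> \<omega>' e"
    have "cluster \<omega> \<one> \<subseteq> cluster \<omega>' \<one>"
      unfolding open_cluster_def component_of_def using \<omega>'(2)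
      by (intro Collect_mono impI, elim rtrancl_mono[THEN subsetD, rotated]) (auto simp: adj_def)
    then show "\<omega>' \<in> ?I \<one>" using \<omega> \<omega>'(1) finite_subset by auto
  qed (use q p in auto)
  also have "\<dots> = theta p" by (simp add: theta_def space_bond_percolation)
  finally show "0 < theta p" .
qed

section \<open>Cutting a large finite cluster out of infinite ones\<close>

text \<open>The edges whose state is prescribed by the surgery. The prescribed state of \<open>e\<close> will be \<open>e \<subseteq> T\<close>,
which closes the edges that leave \<open>W \<union> T\<close>.\<close>

definition surgery_edges :: "'a set \<Rightarrow> 'a set \<Rightarrow> 'a set set" where
  "surgery_edges W T = {e \<in> E. e \<subseteq> T \<or> e \<inter> (W \<union> T) \<noteq> {} \<and> \<not> e \<subseteq> W \<union> T}"

text \<open>An edge that leaves \<open>W \<union> T\<close> has its inner endpoint in \<open>T\<close>: if this endpoint is in \<open>W\<close>, then it belongs to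
the rim. So every edge in question has the form \<open>{t, s \<otimes> t}\<close> with \<open>t\<close> in \<open>T\<close>.\<close>

lemma surgery_edges_bound:
  assumes "sealed W T"
  shows "finite (surgery_edges W T)" "card (surgery_edges W T) \<le> card S * card T"
proof -
  have sub: "surgery_edges W T \<subseteq> (\<lambda>(s, t). {t, s \<otimes> t}) ` (S \<times> T)"
  proof
    fix e assume "e \<in> surgery_edges W T"
    then have e: "e \<in> E" "e \<subseteq> T \<or> e \<inter> (W \<union> T) \<noteq> {} \<and> \<not> e \<subseteq> W \<union> T" by (auto simp: surgery_edges_def)
    then obtain u0 v0 where uv0: "e = {u0, v0}" "u0 \<in> V" "v0 \<in> V" by (auto simp: cayley_edges_def)
    obtain u v where uv: "e = {u, v}" "u \<in> V" "v \<in> V" "u \<in> W \<union> T" "u \<in> T \<or> v \<notin> W \<union> T"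
    proof (cases "u0 \<in> W \<union> T \<and> (u0 \<in> T \<or> v0 \<notin> W \<union> T)")
      case True
      then show thesis using that[of u0 v0] uv0 by blast
    next
      case False
      then have "v0 \<in> W \<union> T \<and> (v0 \<in> T \<or> u0 \<notin> W \<union> T)" using e(2) uv0 by blast
      then show thesis using that[of v0 u0] uv0 by (simp add: insert_commute)
    qed
    obtain s where s: "s \<in> S" "v = s \<otimes> u" using e(1) edge_iff[OF uv(2), of v] uv(1) by blast
    have "u \<in> T"
    proof (rule ccontr)
      assume "u \<notin> T"
      then have "u \<in> W" "v \<notin> W" using uv by auto
      then have "u \<in> rim W" using s by (auto simp: rim_def)
      then show False using assms \<open>u \<notin> T\<close> by (auto simp: sealed_def)
    qed
    then show "e \<in> (\<lambda>(s, t). {t, s \<otimes> t}) ` (S \<times> T)" using s uv(1) by auto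
  qed
  have fin: "finite (S \<times> T)" using assms finite_S by (auto simp: sealed_def)
  then show "finite (surgery_edges W T)" using finite_subset[OF sub] by blast
  show "card (surgery_edges W T) \<le> card S * card T"
    using surj_card_le[OF fin sub] by (simp add: card_cartesian_product)
qed

text \<open>Only edges that leave \<open>W \<union> T\<close> are closed, so open paths inside \<open>W\<close> survive. A vertex of \<open>W\<close> in an
infinite cluster has such a path to the rim, hence to \<open>T\<close>.\<close>

lemma surgery:
  assumes sealed: "sealed W T" and x: "x \<in> W" "infinite (cluster \<omega> x)"
  defines "\<omega>' \<equiv> override_on \<omega> (\<lambda>e. e \<subseteq> T) (surgery_edges W T)"
  shows "{y \<in> W. infinite (cluster \<omega> y)} \<subseteq> cluster \<omega>' x" "cluster \<omega>' x \<subseteq> W \<union> T"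
proof -
  let ?R = "adj V {e \<in> E. \<omega> e}" and ?R' = "adj V {e \<in> E. \<omega>' e}"
  have WT: "finite W" "W \<subseteq> V" "T \<subseteq> V" "connected_graph T E" "rim W \<subseteq> T" using sealed by (auto simp: sealed_def)
  have to_T: "\<exists>t\<in>T. (y, t) \<in> ?R'\<^sup>*" if y: "y \<in> W" "infinite (cluster \<omega> y)" for y
  proof -
    have "\<not> cluster \<omega> y \<subseteq> W" using y(2) WT(1) finite_subset by blast
    then obtain z where z: "(y, z) \<in> ?R\<^sup>*" "z \<notin> W" unfolding open_cluster_def component_of_def by blast
    let ?A = "{u \<in> W. (y, u) \<in> ?R'\<^sup>*}"
    have "y \<in> ?A" "z \<notin> ?A" using y z by auto
    from z(1) this obtain u v where "(y, u) \<in> ?R\<^sup>*" and uv: "u \<in> ?A" "(u, v) \<in> ?R" "v \<notin> ?A"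
      by (rule rtrancl_exits)
    then have e: "{u, v} \<in> E" "\<omega> {u, v}" "u \<in> V" "v \<in> V" by (auto simp: adj_def)
    have "v \<notin> W"
    proof
      assume "v \<in> W"
      then have "{u, v} \<subseteq> W \<union> T" using uv(1) by blast
      then have "\<omega>' {u, v}" using e(2) by (auto simp: \<omega>'_def override_on_def surgery_edges_def)
      then have "(u, v) \<in> ?R'" using e by (auto simp: adj_def)
      then have "(y, v) \<in> ?R'\<^sup>*" using uv(1) by (auto intro: rtrancl_into_rtrancl)
      then show False using uv(3) \<open>v \<in> W\<close> by blast
    qed
    moreover obtain s where "s \<in> S" "v = s \<otimes> u" using e(1) edge_iff[OF e(3), of v] by blast
    ultimately have "u \<in> rim W" using uv(1) by (auto simp: rim_def)
    then show ?thesis using uv(1) WT(5) by blast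
  qed
  have T_conn: "(t, t') \<in> ?R'\<^sup>*" if "t \<in> T" "t' \<in> T" for t t'
  proof -
    have "(t, t') \<in> (adj T E)\<^sup>*" using WT(4) that by (auto simp: connected_graph_def)
    moreover have "adj T E \<subseteq> ?R'"
      using WT(3) by (auto simp: adj_def \<omega>'_def override_on_def surgery_edges_def)
    ultimately show ?thesis using rtrancl_mono by blast
  qed
  show "{y \<in> W. infinite (cluster \<omega> y)} \<subseteq> cluster \<omega>' x"
  proof
    fix y assume "y \<in> {y \<in> W. infinite (cluster \<omega> y)}"
    then obtain t t' where t: "t \<in> T" "t' \<in> T" "(y, t) \<in> ?R'\<^sup>*" "(x, t') \<in> ?R'\<^sup>*"
      using to_T x by blast
    have "(t, y) \<in> ?R'\<^sup>*" using t(3) by (rule adj_rtrancl_sym)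
    with t(4) T_conn[OF t(2,1)] have "(x, y) \<in> ?R'\<^sup>*" by (meson rtrancl_trans)
    then show "y \<in> cluster \<omega>' x" by (simp add: open_cluster_def component_of_def)
  qed
  show "cluster \<omega>' x \<subseteq> W \<union> T"
  proof
    fix y assume "y \<in> cluster \<omega>' x"
    then have "(x, y) \<in> ?R'\<^sup>*" by (simp add: open_cluster_def component_of_def)
    then show "y \<in> W \<union> T"
    proof (induction rule: rtrancl_induct)
      case (step u v)
      then have e: "{u, v} \<in> E" "\<omega>' {u, v}" by (auto simp: adj_def)
      show ?case
      proof (rule ccontr)
        assume "v \<notin> W \<union> T"
        then have "{u, v} \<in> surgery_edges W T" "\<not> {u, v} \<subseteq> T" using e(1) step.IH by (auto simp: surgery_edges_def)
        then show False using e(2) by (simp add: \<omega>'_def override_on_def)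
      qed
    qed (use x in simp)
  qed
qed

text \<open>Among the vertices of \<open>W\<close> that lie in infinite clusters, each one ends up after the surgery in a
finite cluster containing all of them. The expected number of vertices in \<open>W\<close> for which there are
at least \<open>n\<close> of them is at least \<open>theta p * card W - n\<close>.\<close>

lemma cluster_tail_lower_bound:
  assumes sealed: "sealed W T" and p: "0 < p" "p < 1" and theta: "0 < theta p"
    and big: "2 * real n \<le> theta p * card W" and n: "0 < n"
  shows "theta p / 2 * (p * (1 - p)) ^ (card S * card T)
    \<le> measure (perc p) {\<omega> \<in> space (perc p). finite (cluster \<omega> \<one>) \<and> n \<le> card (cluster \<omega> \<one>)}"
proof -
  interpret prob_space "perc p" by (rule prob_space_bond_percolation)
  define B where "B x = {\<omega> \<in> space (perc p). infinite (cluster \<omega> x)}" for x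
  define A where "A x = {\<omega> \<in> space (perc p). finite (cluster \<omega> x) \<and> n \<le> card (cluster \<omega> x)}" for x
  let ?F = "surgery_edges W T" and ?q = "p * (1 - p)"
  let ?D = "\<lambda>x. {\<omega> \<in> B x. n \<le> card {y \<in> W. \<omega> \<in> B y}}"
  have W: "finite W" "W \<subseteq> V" "finite T" using sealed by (auto simp: sealed_def)
  have B: "B x \<in> sets (perc p)" "measure (perc p) (B x) = theta p" if "x \<in> W" for x
    unfolding B_def using that W sets_cluster_infinite[OF countable_V] theta_eq by auto
  have A: "A x \<in> sets (perc p)" "measure (perc p) (A x) = measure (perc p) (A \<one>)" if "x \<in> V" for x
    unfolding A_def using that perc_translation_invariant[OF that, of p "\<lambda>f c. f \<and> n \<le> c"]
      sets_cluster_size_ge[OF countable_V] by auto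
  have F: "finite ?F" "card ?F \<le> card S * card T" "?F \<subseteq> E"
    using surgery_edges_bound[OF sealed] by (auto simp: surgery_edges_def)
  have q: "0 < ?q" "?q \<le> 1" using p by (auto simp: mult_le_one)
  have bound: "?q ^ (card S * card T) * prob (?D x) \<le> prob (A \<one>)" if x: "x \<in> W" for x
  proof -
    let ?A' = "{\<omega> \<in> space (perc p). override_on \<omega> (\<lambda>e. e \<subseteq> T) ?F \<in> A x}"
    have xV: "x \<in> V" using x W by blast
    note fe = finite_energy[OF F(1,3) less_imp_le[OF p(1)] less_imp_le[OF p(2)] A(1)[OF xV], of "\<lambda>e. e \<subseteq> T"]
    have "?D x \<subseteq> ?A'"
    proof
      fix \<omega> assume \<omega>: "\<omega> \<in> ?D x"
      let ?\<omega>' = "override_on \<omega> (\<lambda>e. e \<subseteq> T) ?F"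
      have sp: "\<omega> \<in> space (perc p)" and infx: "infinite (cluster \<omega> x)" using \<omega> by (auto simp: B_def)
      have sp': "?\<omega>' \<in> space (perc p)"
        using sp F(3) by (auto simp: space_bond_percolation PiE_iff extensional_def override_on_def)
      have fin: "finite (cluster ?\<omega>' x)"
        using surgery(2)[OF sealed x infx] W finite_subset by blast
      have "{y \<in> W. \<omega> \<in> B y} \<subseteq> cluster ?\<omega>' x"
        using surgery(1)[OF sealed x infx] by (auto simp: B_def)
      from card_mono[OF fin this] have "n \<le> card (cluster ?\<omega>' x)" using \<omega> by simp
      then show "\<omega> \<in> ?A'" using sp sp' fin by (simp add: A_def)
    qed
    then have "prob (?D x) \<le> prob ?A'" by (rule finite_measure_mono[OF _ fe[THEN conjunct1]])
    moreover have "?q ^ (card S * card T) \<le> ?q ^ card ?F" using q F(2) by (intro power_decreasing) auto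
    ultimately have "?q ^ (card S * card T) * prob (?D x) \<le> ?q ^ card ?F * prob ?A'"
      using q by (intro mult_mono) auto
    also have "\<dots> \<le> prob (A \<one>)" using fe A(2)[OF xV] by simp
    finally show ?thesis .
  qed
  have "theta p / 2 * card W \<le> theta p * card W - n" using big by linarith
  also have "\<dots> = (\<Sum>x\<in>W. prob (B x)) - n" using B by simp
  also have "\<dots> \<le> (\<Sum>x\<in>W. prob (?D x))"
    by (rule expected_count_truncated[OF prob_space_axioms W(1) B(1)])
  finally have "?q ^ (card S * card T) * (theta p / 2 * card W) \<le> ?q ^ (card S * card T) * (\<Sum>x\<in>W. prob (?D x))"
    using q by (intro mult_left_mono) auto
  also have "\<dots> = (\<Sum>x\<in>W. ?q ^ (card S * card T) * prob (?D x))" by (rule sum_distrib_left)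
  also have "\<dots> \<le> (\<Sum>x\<in>W. prob (A \<one>))" by (rule sum_mono[OF bound])
  also have "\<dots> = prob (A \<one>) * card W" by simp
  finally have "(theta p / 2 * ?q ^ (card S * card T)) * card W \<le> prob (A \<one>) * card W" by (simp add: mult_ac)
  moreover have "0 < real (card W)"
  proof (rule ccontr)
    assume "\<not> 0 < real (card W)"
    then show False using big n by simp
  qed
  ultimately show ?thesis unfolding A_def by simp
qed

section \<open>The sublinear sequence\<close>

definition sealing_cost :: "nat \<Rightarrow> nat" where
  "sealing_cost m = (LEAST t. \<exists>W T. sealed W T \<and> m \<le> card W \<and> card T = t)"

lemma sealing_cost_attained:
  assumes "amenable_group G" "one_ended_group G" "infinite V"
  shows "\<exists>W T. sealed W T \<and> m \<le> card W \<and> card T = sealing_cost m"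
proof -
  obtain M where M: "\<forall>m\<ge>M. \<exists>W T. sealed W T \<and> m \<le> card W \<and> real (card T) \<le> 1 * m"
    using cheap_sealed_sets[OF assms, of 1] by auto
  obtain W T where "sealed W T" "max m M \<le> card W" using M[rule_format, of "max m M"] by auto
  then have "\<exists>t W T. sealed W T \<and> m \<le> card W \<and> card T = t" by auto
  then show ?thesis unfolding sealing_cost_def by (rule LeastI_ex)
qed

text \<open>The summand \<open>1\<close> makes room for the constant factor \<open>\<theta> / 2\<close> in the lower bound on the probability.\<close>

lemma sealing_cost_sublinear:
  assumes "amenable_group G" "one_ended_group G" "infinite V"
  shows "(\<lambda>m. (1 + real (sealing_cost m)) / real m) \<longlonglongrightarrow> 0"
proof (rule LIMSEQ_I)
  fix \<epsilon> :: real assume \<epsilon>: "0 < \<epsilon>"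
  obtain M where M: "\<And>m. M \<le> m \<Longrightarrow> \<exists>W T. sealed W T \<and> m \<le> card W \<and> real (card T) \<le> \<epsilon> / 3 * m"
    using cheap_sealed_sets[OF assms, of "\<epsilon> / 3"] \<epsilon> by auto
  define N where "N = max (M + 1) (nat \<lceil>3 / \<epsilon>\<rceil>)"
  have "norm ((1 + real (sealing_cost m)) / real m - 0) < \<epsilon>" if "N \<le> m" for m
  proof -
    have m: "M \<le> m" "0 < m" "3 / \<epsilon> \<le> m" using that unfolding N_def by linarith+
    obtain W T where WT: "sealed W T" "m \<le> card W" "real (card T) \<le> \<epsilon> / 3 * m" using M[OF m(1)] by blast
    have "sealing_cost m \<le> card T" unfolding sealing_cost_def using WT by (intro Least_le) blast
    moreover have "1 \<le> \<epsilon> / 3 * m" using m(3) \<epsilon> by (simp add: field_simps)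
    ultimately have "1 + real (sealing_cost m) \<le> 2 * (\<epsilon> / 3 * m)" using WT(3) by linarith
    also have "\<dots> < \<epsilon> * m" using \<epsilon> m(2) by simp
    finally show ?thesis using m(2) by (simp add: field_simps)
  qed
  then show "\<exists>N. \<forall>m\<ge>N. norm ((1 + real (sealing_cost m)) / real m - 0) < \<epsilon>" by blast
qed

end

text \<open>Let \<open>\<alpha> n\<close> be \<open>n\<close> times the supremum of \<open>f m / m\<close> over \<open>m \<ge> n\<close>. The supremum tends to \<open>0\<close> with
\<open>f m / m\<close>, and taking \<open>m = k * n\<close> shows \<open>f (k * n) \<le> k * n * (\<alpha> n / n)\<close>.\<close>

lemma scaling_majorant:
  fixes f :: "nat \<Rightarrow> real"
  assumes f: "(\<lambda>m. f m / real m) \<longlonglongrightarrow> 0"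
  shows "\<exists>\<alpha>. \<alpha> \<in> o(\<lambda>n. real n) \<and> (\<forall>k\<ge>1. \<forall>n\<ge>1. f (k * n) \<le> real k * \<alpha> n)"
proof -
  let ?g = "\<lambda>m. f m / real m"
  define \<alpha> where "\<alpha> n = real n * (SUP m\<in>{n..}. ?g m)" for n
  have "Bseq ?g" using f by (intro convergent_imp_Bseq convergentI)
  then obtain K where "\<And>m. \<bar>?g m\<bar> \<le> K" by (auto simp: Bseq_def)
  then have bdd: "bdd_above (?g ` X)" for X by (intro bdd_aboveI2[of _ _ K]) (metis abs_le_D1)
  have le: "?g m \<le> (SUP m\<in>{n..}. ?g m)" if "n \<le> m" for m n
    using that by (intro cSUP_upper bdd) auto
  have lim: "(\<lambda>n. SUP m\<in>{n..}. ?g m) \<longlonglongrightarrow> 0"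
  proof (rule LIMSEQ_I)
    fix \<epsilon> :: real assume \<epsilon>: "0 < \<epsilon>"
    obtain N where N: "\<And>m. N \<le> m \<Longrightarrow> \<bar>?g m\<bar> < \<epsilon> / 2"
      using LIMSEQ_D[OF f, of "\<epsilon> / 2"] \<epsilon> by auto
    have "norm ((SUP m\<in>{n..}. ?g m) - 0) < \<epsilon>" if "N \<le> n" for n
    proof -
      have "(SUP m\<in>{n..}. ?g m) \<le> \<epsilon> / 2"
      proof (rule cSUP_least)
        fix m assume "m \<in> {n..}"
        then have "N \<le> m" using that by simp
        from N[OF this] show "?g m \<le> \<epsilon> / 2" by linarith
      qed simp
      moreover have "- (\<epsilon> / 2) \<le> (SUP m\<in>{n..}. ?g m)" using le[of n n] N[OF that] by linarith
      ultimately show ?thesis using \<epsilon> by simp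
    qed
    then show "\<exists>N. \<forall>n\<ge>N. norm ((SUP m\<in>{n..}. ?g m) - 0) < \<epsilon>" by blast
  qed
  have "\<alpha> \<in> o(\<lambda>n. real n)"
  proof (rule smalloI_tendsto)
    have "eventually (\<lambda>n. (SUP m\<in>{n..}. ?g m) = \<alpha> n / real n) sequentially"
      using eventually_gt_at_top[of 0] by eventually_elim (simp add: \<alpha>_def)
    from Lim_transform_eventually[OF lim this] show "(\<lambda>n. \<alpha> n / real n) \<longlonglongrightarrow> 0" .
    show "eventually (\<lambda>n. real n \<noteq> 0) sequentially" using eventually_gt_at_top[of 0] by eventually_elim simp
  qed
  moreover have "f (k * n) \<le> real k * \<alpha> n" if "1 \<le> k" "1 \<le> n" for k n
  proof -
    have "f (k * n) = real k * (real n * ?g (k * n))" using that by simp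
    also have "\<dots> \<le> real k * \<alpha> n"
      unfolding \<alpha>_def using le[of n "k * n"] that by (intro mult_left_mono) auto
    finally show ?thesis .
  qed
  ultimately show ?thesis by blast
qed

theorem theorem3:
  fixes G :: "('a, 'b) monoid_scheme" and S :: "'a set"
  assumes "group G"
    and "symmetric_generating_set G S"
    and "finitely_presented_group G"
    and "amenable_group G"
    and "one_ended_group G"
  shows "\<exists>\<alpha> :: nat \<Rightarrow> real. \<alpha> \<in> o(\<lambda>n. real n) \<and>
    (\<forall>p :: real. critical_probability (carrier G) (cayley_edges G S) < p \<and> p < 1 \<longrightarrow>
      (\<exists>\<eta> :: real. \<forall>n\<ge>1.
        measure (bond_percolation (cayley_edges G S) p)
          {\<omega> \<in> space (bond_percolation (cayley_edges G S) p).
             finite (open_cluster (carrier G) (cayley_edges G S) \<omega> \<one>\<^bsub>G\<^esub>) \<and>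
             n \<le> card (open_cluster (carrier G) (cayley_edges G S) \<omega> \<one>\<^bsub>G\<^esub>)}
        \<ge> exp (- \<eta> * \<alpha> n)))"
proof -
  interpret marked_group G S
    using assms(1,2) by (simp add: marked_group_def marked_group_axioms_def)
  have inf: "infinite (carrier G)" using assms(4) by (auto simp: amenable_group_def amenable_graph_def)
  obtain \<alpha> where \<alpha>: "\<alpha> \<in> o(\<lambda>n. real n)"
    and maj: "\<And>k n. 1 \<le> k \<Longrightarrow> 1 \<le> n \<Longrightarrow> 1 + real (sealing_cost (k * n)) \<le> real k * \<alpha> n"
    using scaling_majorant[OF sealing_cost_sublinear[OF assms(4,5) inf]] by blast
  have "\<exists>\<eta>. \<forall>n\<ge>1. exp (- \<eta> * \<alpha> n) \<le> measure (perc p)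
      {\<omega> \<in> space (perc p). finite (cluster \<omega> \<one>\<^bsub>G\<^esub>) \<and> n \<le> card (cluster \<omega> \<one>\<^bsub>G\<^esub>)}"
    if p: "critical_probability (carrier G) (cayley_edges G S) < p" "p < 1" for p
  proof -
    note pos = theta_pos[OF inf p]
    \<comment> \<open>A set W with k n elements satisfies 2 n \<le> theta p |W|.\<close>
    define k where "k = nat \<lceil>2 / theta p\<rceil>"
    have k: "2 / theta p \<le> k" unfolding k_def by linarith
    moreover have "0 < 2 / theta p" using pos by simp
    ultimately have k1: "1 \<le> k" by linarith
    let ?q = "p * (1 - p)"
    have q: "0 < ?q" using pos(1) p(2) by simp
    \<comment> \<open>One constant that controls both the factor theta p / 2 and the cost of a vertex of T.\<close>
    define c where "c = max \<bar>ln (theta p / 2)\<bar> (real (card S) * - ln ?q)"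
    have c: "0 \<le> c" "- c \<le> ln (theta p / 2)" "real (card S) * - ln ?q \<le> c" unfolding c_def by auto
    have "exp (- (c * k) * \<alpha> n) \<le> measure (perc p)
        {\<omega> \<in> space (perc p). finite (cluster \<omega> \<one>\<^bsub>G\<^esub>) \<and> n \<le> card (cluster \<omega> \<one>\<^bsub>G\<^esub>)}" if n: "1 \<le> n" for n
    proof -
      obtain W T where WT: "sealed W T" "k * n \<le> card W" "card T = sealing_cost (k * n)"
        using sealing_cost_attained[OF assms(4,5) inf] by blast
      have "2 * real n = theta p * ((2 / theta p) * n)" using pos by simp
      also have "\<dots> \<le> theta p * (k * n)" using mult_right_mono[OF k, of "real n"] pos by (intro mult_left_mono) auto
      also have "\<dots> \<le> theta p * card W" using WT(2) pos by (intro mult_left_mono) (auto simp flip: of_nat_mult)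
      finally have big: "2 * real n \<le> theta p * card W" .
      have "c * (1 + real (card T)) \<le> c * (k * \<alpha> n)" using maj[OF k1 n] WT(3) c(1) by (intro mult_left_mono) auto
      moreover have "real (card S) * - ln ?q * card T \<le> c * card T" using c(3) by (intro mult_right_mono) auto
      ultimately have "- (c * k) * \<alpha> n \<le> ln (theta p / 2) + real (card S * card T) * ln ?q"
        using c(2) by (simp add: algebra_simps)
      then have "exp (- (c * k) * \<alpha> n) \<le> exp (ln (theta p / 2) + real (card S * card T) * ln ?q)" by simp
      also have "\<dots> = theta p / 2 * ?q ^ (card S * card T)"
        using pos(2) q by (simp add: exp_add exp_of_nat_mult del: of_nat_mult)
      also have "\<dots> \<le> measure (perc p)
        {\<omega> \<in> space (perc p). finite (cluster \<omega> \<one>\<^bsub>G\<^esub>) \<and> n \<le> card (cluster \<omega> \<one>\<^bsub>G\<^esub>)}"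
        using n by (intro cluster_tail_lower_bound[OF WT(1) pos(1) p(2) pos(2) big]) auto
      finally show ?thesis .
    qed
    then show ?thesis by blast
  qed
  then show ?thesis using \<alpha> by blast
qed

end
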